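(* Let $(\Omega,\mathcal{A},\mathbb{P},\mathbb{D},\Gamma)$ be an error structure with generator $(A,\mathcal{D}A)$, and let $X$ be a real-valued random variable. (a) If $X\in\mathcal{D}A$, $\Gamma[X]\in\mathbb{D}$ and $\Gamma[X]>0$ almost surely, then $X$ has a density $f$ (with respect to Lebesgue measure on $\mathbb{R}$) which possesses a lower semicontinuous version $\tilde f$ given, for every $x\in\mathbb{R}$, by the increasing limit $$\tilde f(x)=\lim_{\varepsilon\downarrow 0}\uparrow\ \frac12\,\mathbb{E}\left[\operatorname{sign}(x-X)\left(\Gamma\left[X,\frac{1}{\varepsilon+\Gamma[X]}\right]+\frac{2A[X]}{\varepsilon+\Gamma[X]}\right)\right].$$ (b) If, in addition to the hypotheses of (a), $\frac{1}{\Gamma[X]}\in\mathbb{D}$, then $X$ has a density $f$ which is absolutely continuous and given by $$f(x)=\frac12\,\mathbb{E}\left[\operatorname{sign}(x-X)\left(\Gamma\left[X,\frac{1}{\Gamma[X]}\right]+\frac{2A[X]}{\Gamma[X]}\right)\right].$$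
   Context: An error structure $(\Omega,\mathcal{A},\mathbb{P},\mathbb{D},\Gamma)$ is a probability space $(\Omega,\mathcal{A},\mathbb{P})$ equipped with a local Dirichlet form $(\mathcal{E},\mathbb{D})$ on $L^2(\mathbb{P})$ admitting a square field (carré du champ) operator $\Gamma$. That is: $\mathbb{D}$ is a dense linear subspace of $L^2(\mathbb{P})$ containing the constants; $\Gamma:\mathbb{D}\times\mathbb{D}\to L^1(\mathbb{P})$ is a symmetric, positive ($\Gamma[u,u]\ge 0$) bilinear map satisfying the functional calculus: for $u\in\mathbb{D}^m$, $v\in\mathbb{D}^n$ and $F:\mathbb{R}^m\to\mathbb{R}$, $H:\mathbb{R}^n\to\mathbb{R}$ of class $\mathcal{C}^1$ and Lipschitz, $F(u),H(v)\in\mathbb{D}$ and $\Gamma[F(u),H(v)]=\sum_{i,j}F'_i(u)H'_j(v)\Gamma[u_i,v_j]$ almost surely; and the form $\mathcal{E}[u,v]=\frac12\mathbb{E}\,\Gamma[u,v]$ with domain $\mathbb{D}$ is closed. One writes $\Gamma[u]=\Gamma[u,u]$. The generator $(A,\mathcal{D}A)$ is the self-adjoint operator on $L^2(\mathbb{P})$ associated with $\mathcal{E}$: $\mathcal{D}A\subset\mathbb{D}$ and $\mathcal{E}[u,v]=-\langle A[u],v\rangle_{L^2(\mathbb{P})}$ for all $u\in\mathcal{D}A$, $v\in\mathbb{D}$. The function $\operatorname{sign}$ is the usual sign function. The notation $\lim_{\varepsilon\downarrow0}\uparrow$ means that the quantity increases as $\varepsilon$ decreases to $0$ and the limit is taken.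 *)

theory Defs
  imports "HOL-Probability.Probability"
begin

section \<open>Subspaces and operators of $L^2$\<close>

text \<open>
  Elements of $L^2$ and $L^1$ are represented by measurable functions. Subsets of $L^2$ are
  required to be saturated for almost sure equality, and maps on them to respect it.
\<close>

definition L2 :: "'a measure \<Rightarrow> ('a \<Rightarrow> real) set" where
  "L2 M = {u \<in> borel_measurable M. integrable M (\<lambda>\<omega>. (u \<omega>)\<^sup>2)}"

definition L2_inner :: "'a measure \<Rightarrow> ('a \<Rightarrow> real) \<Rightarrow> ('a \<Rightarrow> real) \<Rightarrow> real" where
  "L2_inner M u v = (\<integral>\<omega>. u \<omega> * v \<omega> \<partial>M)"

definition L2_subspace :: "'a measure \<Rightarrow> ('a \<Rightarrow> real) set \<Rightarrow> bool" where
  "L2_subspace M V \<longleftrightarrow>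
     V \<subseteq> L2 M \<and> V \<noteq> {} \<and>
     (\<forall>u\<in>V. \<forall>v\<in>V. \<forall>a b. (\<lambda>\<omega>. a * u \<omega> + b * v \<omega>) \<in> V) \<and>
     (\<forall>u\<in>V. \<forall>v\<in>borel_measurable M. (AE \<omega> in M. u \<omega> = v \<omega>) \<longrightarrow> v \<in> V)"

definition L2_dense :: "'a measure \<Rightarrow> ('a \<Rightarrow> real) set \<Rightarrow> bool" where
  "L2_dense M V \<longleftrightarrow>
     (\<forall>w\<in>L2 M. \<forall>e>0. \<exists>u\<in>V. (\<integral>\<omega>. (w \<omega> - u \<omega>)\<^sup>2 \<partial>M) < e)"

text \<open>The last conjunct says that the operator coincides with its adjoint, domains included.\<close>

definition L2_self_adjoint ::
  "'a measure \<Rightarrow> ('a \<Rightarrow> real) set \<Rightarrow> (('a \<Rightarrow> real) \<Rightarrow> ('a \<Rightarrow> real)) \<Rightarrow> bool" where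
  "L2_self_adjoint M V A \<longleftrightarrow>
     L2_subspace M V \<and> L2_dense M V \<and>
     (\<forall>u\<in>V. A u \<in> L2 M) \<and>
     (\<forall>u\<in>V. \<forall>v\<in>V. (AE \<omega> in M. u \<omega> = v \<omega>) \<longrightarrow> (AE \<omega> in M. A u \<omega> = A v \<omega>)) \<and>
     (\<forall>u\<in>V. \<forall>v\<in>V. \<forall>a b.
        AE \<omega> in M. A (\<lambda>\<omega>. a * u \<omega> + b * v \<omega>) \<omega> = a * A u \<omega> + b * A v \<omega>) \<and>
     (\<forall>u\<in>L2 M. \<forall>w\<in>L2 M.
        (\<forall>v\<in>V. L2_inner M u (A v) = L2_inner M w v) \<longleftrightarrow>
        u \<in> V \<and> (AE \<omega> in M. A u \<omega> = w \<omega>))"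


section \<open>Functions of class $C^1$ and Lipschitz on $\mathbf{R}^m$\<close>

text \<open>
  Since the functional calculus quantifies over $m$, the space $\mathbf{R}^m$ is
  \<open>Euclidean_space m\<close>, whose points are the \<open>x :: nat \<Rightarrow> real\<close> with \<open>x i = 0\<close> for \<open>i \<ge> m\<close>.
\<close>

definition tuple :: "nat \<Rightarrow> (nat \<Rightarrow> 'a \<Rightarrow> real) \<Rightarrow> 'a \<Rightarrow> (nat \<Rightarrow> real)" where
  "tuple m u \<omega> = (\<lambda>i. if i < m then u i \<omega> else 0)"

definition partial_deriv :: "((nat \<Rightarrow> real) \<Rightarrow> real) \<Rightarrow> nat \<Rightarrow> (nat \<Rightarrow> real) \<Rightarrow> real" where
  "partial_deriv F i x = deriv (\<lambda>t. F (x(i := t))) (x i)"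

definition C1_fun :: "nat \<Rightarrow> ((nat \<Rightarrow> real) \<Rightarrow> real) \<Rightarrow> bool" where
  "C1_fun m F \<longleftrightarrow>
     (\<forall>i<m. (\<forall>x\<in>topspace (Euclidean_space m).
                (\<lambda>t. F (x(i := t))) differentiable at (x i)) \<and>
            continuous_map (Euclidean_space m) euclideanreal (partial_deriv F i))"

definition Lipschitz_fun :: "nat \<Rightarrow> ((nat \<Rightarrow> real) \<Rightarrow> real) \<Rightarrow> bool" where
  "Lipschitz_fun m F \<longleftrightarrow>
     (\<exists>L. \<forall>x\<in>topspace (Euclidean_space m). \<forall>y\<in>topspace (Euclidean_space m).
        \<bar>F x - F y\<bar> \<le> L * L2_set (\<lambda>i. x i - y i) {..<m})"


section \<open>Error structures\<close>

definition dirichlet_form ::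
  "'a measure \<Rightarrow> (('a \<Rightarrow> real) \<Rightarrow> ('a \<Rightarrow> real) \<Rightarrow> ('a \<Rightarrow> real)) \<Rightarrow>
   ('a \<Rightarrow> real) \<Rightarrow> ('a \<Rightarrow> real) \<Rightarrow> real" where
  "dirichlet_form M \<Gamma> u v = 1 / 2 * (\<integral>\<omega>. \<Gamma> u v \<omega> \<partial>M)"

definition closed_form ::
  "'a measure \<Rightarrow> ('a \<Rightarrow> real) set \<Rightarrow> (('a \<Rightarrow> real) \<Rightarrow> ('a \<Rightarrow> real) \<Rightarrow> real) \<Rightarrow> bool" where
  "closed_form M D E \<longleftrightarrow>
     (\<forall>(u :: nat \<Rightarrow> 'a \<Rightarrow> real) w.
        (\<forall>n. u n \<in> D) \<and> w \<in> L2 M \<and>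
        (\<lambda>n. \<integral>\<omega>. (u n \<omega> - w \<omega>)\<^sup>2 \<partial>M) \<longlonglongrightarrow> 0 \<and>
        (\<forall>e>0. \<exists>N. \<forall>m\<ge>N. \<forall>n\<ge>N.
           E (\<lambda>\<omega>. u m \<omega> - u n \<omega>) (\<lambda>\<omega>. u m \<omega> - u n \<omega>) < e)
        \<longrightarrow> w \<in> D \<and> (\<lambda>n. E (\<lambda>\<omega>. u n \<omega> - w \<omega>) (\<lambda>\<omega>. u n \<omega> - w \<omega>)) \<longlonglongrightarrow> 0)"

locale error_structure = prob_space M
  for M :: "'a measure" +
  fixes D :: "('a \<Rightarrow> real) set"
    and \<Gamma> :: "('a \<Rightarrow> real) \<Rightarrow> ('a \<Rightarrow> real) \<Rightarrow> ('a \<Rightarrow> real)"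
  assumes domain_subspace: "L2_subspace M D"
    and domain_dense: "L2_dense M D"
    and domain_const: "(\<lambda>_. c) \<in> D"
    and Gamma_integrable: "\<lbrakk>u \<in> D; v \<in> D\<rbrakk> \<Longrightarrow> integrable M (\<Gamma> u v)"
    and Gamma_cong: "\<lbrakk>u \<in> D; u' \<in> D; v \<in> D; AE \<omega> in M. u \<omega> = u' \<omega>\<rbrakk>
          \<Longrightarrow> AE \<omega> in M. \<Gamma> u v \<omega> = \<Gamma> u' v \<omega>"
    and Gamma_sym: "\<lbrakk>u \<in> D; v \<in> D\<rbrakk> \<Longrightarrow> AE \<omega> in M. \<Gamma> u v \<omega> = \<Gamma> v u \<omega>"
    and Gamma_linear: "\<lbrakk>u \<in> D; v \<in> D; w \<in> D\<rbrakk>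
          \<Longrightarrow> AE \<omega> in M. \<Gamma> (\<lambda>\<omega>. a * u \<omega> + b * v \<omega>) w \<omega> = a * \<Gamma> u w \<omega> + b * \<Gamma> v w \<omega>"
    and Gamma_nonneg: "u \<in> D \<Longrightarrow> AE \<omega> in M. 0 \<le> \<Gamma> u u \<omega>"
    and calculus_domain: "\<lbrakk>\<And>i. i < m \<Longrightarrow> U i \<in> D; C1_fun m F; Lipschitz_fun m F\<rbrakk>
          \<Longrightarrow> (\<lambda>\<omega>. F (tuple m U \<omega>)) \<in> D"
    and calculus_Gamma: "\<lbrakk>\<And>i. i < m \<Longrightarrow> U i \<in> D; C1_fun m F; Lipschitz_fun m F;
            \<And>j. j < n \<Longrightarrow> V j \<in> D; C1_fun n H; Lipschitz_fun n H\<rbrakk>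
          \<Longrightarrow> AE \<omega> in M. \<Gamma> (\<lambda>\<omega>. F (tuple m U \<omega>)) (\<lambda>\<omega>. H (tuple n V \<omega>)) \<omega> =
                (\<Sum>i<m. \<Sum>j<n. partial_deriv F i (tuple m U \<omega>) *
                                partial_deriv H j (tuple n V \<omega>) * \<Gamma> (U i) (V j) \<omega>)"
    and form_closed: "closed_form M D (dirichlet_form M \<Gamma>)"

text \<open>
  A self-adjoint operator with these two properties is almost surely unique, because
  self-adjoint operators have no proper symmetric extension.
\<close>

definition generator ::
  "'a measure \<Rightarrow> ('a \<Rightarrow> real) set \<Rightarrow> (('a \<Rightarrow> real) \<Rightarrow> ('a \<Rightarrow> real) \<Rightarrow> ('a \<Rightarrow> real)) \<Rightarrow>
   ('a \<Rightarrow> real) set \<Rightarrow> (('a \<Rightarrow> real) \<Rightarrow> ('a \<Rightarrow> real)) \<Rightarrow> bool" where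
  "generator M D \<Gamma> DA A \<longleftrightarrow>
     L2_self_adjoint M DA A \<and> DA \<subseteq> D \<and>
     (\<forall>u\<in>DA. \<forall>v\<in>D. dirichlet_form M \<Gamma> u v = - L2_inner M (A u) v)"


section \<open>Regularity of real functions\<close>

definition lower_semicontinuous :: "('a::topological_space \<Rightarrow> 'b::complete_linorder) \<Rightarrow> bool" where
  "lower_semicontinuous f \<longleftrightarrow> (\<forall>x. f x \<le> Liminf (at x) f)"

text \<open>Not to be confused with \<open>absolutely_continuous\<close>, which is about measures.\<close>

definition abs_continuous_on :: "real set \<Rightarrow> (real \<Rightarrow> real) \<Rightarrow> bool" where
  "abs_continuous_on S f \<longleftrightarrow>
     (\<forall>e>0. \<exists>d>0. \<forall>(n::nat) a b.
        (\<forall>i<n. a i \<le> b i \<and> {a i..b i} \<subseteq> S) \<and>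
        (\<forall>i<n. \<forall>j<n. i \<noteq> j \<longrightarrow> {a i<..<b i} \<inter> {a j<..<b j} = {}) \<and>
        (\<Sum>i<n. b i - a i) < d
        \<longrightarrow> (\<Sum>i<n. \<bar>f (b i) - f (a i)\<bar>) < e)"

end

theory Submission
  imports Defs
begin

text \<open>
  Testing the generator against \<open>\<phi>(X) / (\<epsilon> + \<Gamma>[X])\<close> gives the integration by parts formula
  \<open>E[\<phi>'(X) R] = - E[\<phi>(X) W]\<close> with \<open>R = \<Gamma>[X] / (\<epsilon> + \<Gamma>[X])\<close> and
  \<open>W = \<Gamma>[X, 1 / (\<epsilon> + \<Gamma>[X])] + 2 A[X] / (\<epsilon> + \<Gamma>[X])\<close>. Letting \<open>\<phi>'\<close> approach the indicator of an
  interval shows that the image under \<open>X\<close> of the measure \<open>R \<cdot> P\<close> has the continuous density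
  \<open>x \<mapsto> E[sign(x - X) W] / 2\<close>. As \<open>\<epsilon>\<close> decreases to \<open>0\<close>, \<open>R\<close> increases to \<open>1\<close>, and the densities increase to
  a density of \<open>X\<close>, which is lower semicontinuous as a supremum of continuous functions. If
  \<open>1 / \<Gamma>[X]\<close> lies in the domain, the formula passes to the limit with \<open>R = 1\<close>. The density is then
  bounded by \<open>E\<bar>W\<bar> / 2\<close>, so \<open>X\<close> falls in a set of small Lebesgue measure with small probability; since the
  increments of the density are at most \<open>E[\<bar>W\<bar>; a < X < b]\<close> and \<open>W\<close> is integrable, it is absolutely
  continuous.
\<close>

section \<open>Integration by parts and densities\<close>

definition sign_mean :: "'a measure \<Rightarrow> ('a \<Rightarrow> real) \<Rightarrow> ('a \<Rightarrow> real) \<Rightarrow> real \<Rightarrow> real" where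
  "sign_mean M X W x = 1 / 2 * (\<integral>\<omega>. sgn (x - X \<omega>) * W \<omega> \<partial>M)"

text \<open>The density arguments see the error structure only through this formula. The weights
  \<open>R\<close> and \<open>W\<close> stay abstract so that formulas can be subtracted and passed
  to limits. Integrability is part of the notion because a Bochner integral of a nonintegrable
  function is 0 by convention.\<close>

definition ibp_pair :: "'a measure \<Rightarrow> ('a \<Rightarrow> real) \<Rightarrow> ('a \<Rightarrow> real) \<Rightarrow> ('a \<Rightarrow> real) \<Rightarrow> bool" where
  "ibp_pair M X R W \<longleftrightarrow>
     integrable M R \<and> integrable M W \<and>
     (\<forall>\<phi> \<phi>'. (\<forall>x. (\<phi> has_real_derivative \<phi>' x) (at x)) \<longrightarrow> continuous_on UNIV \<phi>' \<longrightarrow>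
        bounded (range \<phi>) \<longrightarrow> bounded (range \<phi>') \<longrightarrow>
        (\<integral>\<omega>. \<phi>' (X \<omega>) * R \<omega> \<partial>M) = - (\<integral>\<omega>. \<phi> (X \<omega>) * W \<omega> \<partial>M))"

lemma ibp_pairD:
  assumes "ibp_pair M X R W" "\<And>x. (\<phi> has_real_derivative \<phi>' x) (at x)" "continuous_on UNIV \<phi>'"
    "bounded (range \<phi>)" "bounded (range \<phi>')"
  shows "(\<integral>\<omega>. \<phi>' (X \<omega>) * R \<omega> \<partial>M) = - (\<integral>\<omega>. \<phi> (X \<omega>) * W \<omega> \<partial>M)"
  using assms unfolding ibp_pair_def by blast

section \<open>Bounded multipliers and stability of the integration by parts formula\<close>

lemma integrable_bounded_mult:
  fixes W :: "'a \<Rightarrow> real"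
  assumes W: "integrable M W" and h[measurable]: "h \<in> borel_measurable M"
    and bd: "\<And>\<omega>. \<bar>h \<omega>\<bar> \<le> B"
  shows "integrable M (\<lambda>\<omega>. h \<omega> * W \<omega>)"
proof (rule Bochner_Integration.integrable_bound[where f = "\<lambda>\<omega>. B * W \<omega>"])
  show "integrable M (\<lambda>\<omega>. B * W \<omega>)" using W by simp
  show "(\<lambda>\<omega>. h \<omega> * W \<omega>) \<in> borel_measurable M"
    using borel_measurable_integrable[OF W] by measurable
  have "\<bar>h \<omega>\<bar> * \<bar>W \<omega>\<bar> \<le> \<bar>B\<bar> * \<bar>W \<omega>\<bar>" for \<omega>
    using bd[of \<omega>] by (intro mult_right_mono) auto
  then show "AE \<omega> in M. norm (h \<omega> * W \<omega>) \<le> norm (B * W \<omega>)"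
    by (simp add: abs_mult)
qed

lemma tendsto_integral_bounded_mult:
  fixes W :: "'a \<Rightarrow> real" and h :: "nat \<Rightarrow> 'a \<Rightarrow> real"
  assumes W: "integrable M W" and h[measurable]: "\<And>n. h n \<in> borel_measurable M" "k \<in> borel_measurable M"
    and bd: "\<And>n \<omega>. \<bar>h n \<omega>\<bar> \<le> B"
    and lim: "AE \<omega> in M. (\<lambda>n. h n \<omega>) \<longlonglongrightarrow> k \<omega>"
  shows "(\<lambda>n. \<integral>\<omega>. h n \<omega> * W \<omega> \<partial>M) \<longlonglongrightarrow> (\<integral>\<omega>. k \<omega> * W \<omega> \<partial>M)"
proof (rule integral_dominated_convergence[where w = "\<lambda>\<omega>. B * \<bar>W \<omega>\<bar>"])
  note [measurable] = borel_measurable_integrable[OF W]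
  show "(\<lambda>\<omega>. k \<omega> * W \<omega>) \<in> borel_measurable M" "\<And>n. (\<lambda>\<omega>. h n \<omega> * W \<omega>) \<in> borel_measurable M"
    by measurable
  show "integrable M (\<lambda>\<omega>. B * \<bar>W \<omega>\<bar>)" using W by simp
  show "AE \<omega> in M. (\<lambda>n. h n \<omega> * W \<omega>) \<longlonglongrightarrow> k \<omega> * W \<omega>"
    using lim by eventually_elim (intro tendsto_intros)
  show "AE \<omega> in M. norm (h n \<omega> * W \<omega>) \<le> B * \<bar>W \<omega>\<bar>" for n
    using bd by (auto simp: abs_mult intro!: mult_right_mono)
qed

text \<open>Both sides are linear in the pair of weights. The difference of two pairs is what later
  turns monotonicity of \<open>R\<close> in \<epsilon> into monotonicity of the densities.\<close>

lemma ibp_pair_diff: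
  assumes "ibp_pair M X R W" "ibp_pair M X R' W'" and [measurable]: "X \<in> borel_measurable M"
  shows "ibp_pair M X (\<lambda>\<omega>. R \<omega> - R' \<omega>) (\<lambda>\<omega>. W \<omega> - W' \<omega>)"
  unfolding ibp_pair_def
proof (intro conjI allI impI)
  show "integrable M (\<lambda>\<omega>. R \<omega> - R' \<omega>)" "integrable M (\<lambda>\<omega>. W \<omega> - W' \<omega>)"
    using assms by (auto simp: ibp_pair_def)
  fix \<phi> \<phi>' :: "real \<Rightarrow> real"
  assume d: "\<forall>x. (\<phi> has_real_derivative \<phi>' x) (at x)" and c: "continuous_on UNIV \<phi>'"
    and b: "bounded (range \<phi>)" "bounded (range \<phi>')"
  have "continuous_on UNIV \<phi>"
    using d by (auto intro: DERIV_continuous_on)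
  then have [measurable]: "\<phi> \<in> borel_measurable borel" "\<phi>' \<in> borel_measurable borel"
    using c by (auto intro: borel_measurable_continuous_onI)
  obtain B B' where B: "\<And>x. \<bar>\<phi> x\<bar> \<le> B" "\<And>x. \<bar>\<phi>' x\<bar> \<le> B'"
    using b unfolding bounded_iff by auto
  have i: "integrable M (\<lambda>\<omega>. \<phi>' (X \<omega>) * R \<omega>)" "integrable M (\<lambda>\<omega>. \<phi>' (X \<omega>) * R' \<omega>)"
    "integrable M (\<lambda>\<omega>. \<phi> (X \<omega>) * W \<omega>)" "integrable M (\<lambda>\<omega>. \<phi> (X \<omega>) * W' \<omega>)"
    using assms B unfolding ibp_pair_def
    by (auto intro!: integrable_bounded_mult)
  have "(\<integral>\<omega>. \<phi>' (X \<omega>) * R \<omega> \<partial>M) = - (\<integral>\<omega>. \<phi> (X \<omega>) * W \<omega> \<partial>M)"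
    "(\<integral>\<omega>. \<phi>' (X \<omega>) * R' \<omega> \<partial>M) = - (\<integral>\<omega>. \<phi> (X \<omega>) * W' \<omega> \<partial>M)"
    using assms d c b unfolding ibp_pair_def by blast+
  then show "(\<integral>\<omega>. \<phi>' (X \<omega>) * (R \<omega> - R' \<omega>) \<partial>M) = - (\<integral>\<omega>. \<phi> (X \<omega>) * (W \<omega> - W' \<omega>) \<partial>M)"
    using i by (simp add: right_diff_distrib)
qed

text \<open>For a fixed test function, \<phi> and its derivative are bounded multipliers, so each
  side converges by domination. This carries the formula to \<epsilon> = 0.\<close>

lemma ibp_pair_limit:
  assumes ibp: "\<And>n. ibp_pair M X (R n) (W n)" and X[measurable]: "X \<in> borel_measurable M"
    and R: "AE \<omega> in M. (\<lambda>n. R n \<omega>) \<longlonglongrightarrow> R' \<omega>" "\<And>n. AE \<omega> in M. \<bar>R n \<omega>\<bar> \<le> r \<omega>" "integrable M r"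
    and W: "AE \<omega> in M. (\<lambda>n. W n \<omega>) \<longlonglongrightarrow> W' \<omega>" "\<And>n. AE \<omega> in M. \<bar>W n \<omega>\<bar> \<le> w \<omega>" "integrable M w"
    and meas[measurable]: "R' \<in> borel_measurable M" "W' \<in> borel_measurable M"
  shows "ibp_pair M X R' W'"
  unfolding ibp_pair_def
proof (intro conjI allI impI)
  have [measurable]: "R n \<in> borel_measurable M" "W n \<in> borel_measurable M" for n
    using ibp[of n] by (auto simp: ibp_pair_def)
  show "integrable M R'"
    by (rule integrable_dominated_convergence[where s = R and w = r]) (use R in auto)
  show "integrable M W'"
    by (rule integrable_dominated_convergence[where s = W and w = w]) (use W in auto)
  fix \<phi> \<phi>' :: "real \<Rightarrow> real"
  assume d: "\<forall>x. (\<phi> has_real_derivative \<phi>' x) (at x)" and c: "continuous_on UNIV \<phi>'"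
    and b: "bounded (range \<phi>)" "bounded (range \<phi>')"
  have "continuous_on UNIV \<phi>"
    using d by (auto intro: DERIV_continuous_on)
  then have [measurable]: "\<phi> \<in> borel_measurable borel" "\<phi>' \<in> borel_measurable borel"
    using c by (auto intro: borel_measurable_continuous_onI)
  obtain B B' where B: "\<And>x. \<bar>\<phi> x\<bar> \<le> B" "\<And>x. \<bar>\<phi>' x\<bar> \<le> B'"
    using b unfolding bounded_iff by auto
  \<comment> \<open>One statement of dominated convergence serves both sides: the derivative of
    \<phi> with the \<open>R n\<close>, and \<phi> with the \<open>W n\<close>.\<close>
  have *: "(\<lambda>n. \<integral>\<omega>. h (X \<omega>) * u n \<omega> \<partial>M) \<longlonglongrightarrow> (\<integral>\<omega>. h (X \<omega>) * u' \<omega> \<partial>M)"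
    if [measurable]: "h \<in> borel_measurable borel" "\<And>n. u n \<in> borel_measurable M" "u' \<in> borel_measurable M"
      and "\<And>x. \<bar>h x\<bar> \<le> C" and u: "AE \<omega> in M. (\<lambda>n. u n \<omega>) \<longlonglongrightarrow> u' \<omega>"
      "\<And>n. AE \<omega> in M. \<bar>u n \<omega>\<bar> \<le> v \<omega>" "integrable M v"
    for h :: "real \<Rightarrow> real" and u :: "nat \<Rightarrow> _ \<Rightarrow> real" and u' v C
  proof (rule integral_dominated_convergence[where w = "\<lambda>\<omega>. C * v \<omega>"])
    show "(\<lambda>\<omega>. h (X \<omega>) * u' \<omega>) \<in> borel_measurable M" "\<And>n. (\<lambda>\<omega>. h (X \<omega>) * u n \<omega>) \<in> borel_measurable M"
      by measurable
    show "integrable M (\<lambda>\<omega>. C * v \<omega>)" using u by simp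
    show "AE \<omega> in M. (\<lambda>n. h (X \<omega>) * u n \<omega>) \<longlonglongrightarrow> h (X \<omega>) * u' \<omega>"
      using u(1) by eventually_elim (intro tendsto_intros)
    have "0 \<le> C" using that(4)[of 0] by linarith
    show "AE \<omega> in M. norm (h (X \<omega>) * u n \<omega>) \<le> C * v \<omega>" for n
      using u(2)[of n]
      by eventually_elim (use \<open>0 \<le> C\<close> in \<open>auto simp: abs_mult intro!: mult_mono that(4)\<close>)
  qed
  have "(\<lambda>n. - (\<integral>\<omega>. \<phi> (X \<omega>) * W n \<omega> \<partial>M)) \<longlonglongrightarrow> - (\<integral>\<omega>. \<phi> (X \<omega>) * W' \<omega> \<partial>M)"
    by (intro tendsto_minus *[where v = w and C = B]) (use W B in auto)
  moreover have "(\<lambda>n. (\<integral>\<omega>. \<phi>' (X \<omega>) * R n \<omega> \<partial>M)) \<longlonglongrightarrow> (\<integral>\<omega>. \<phi>' (X \<omega>) * R' \<omega> \<partial>M)"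
    by (intro *[where v = r and C = B']) (use R B in auto)
  moreover have "(\<integral>\<omega>. \<phi>' (X \<omega>) * R n \<omega> \<partial>M) = - (\<integral>\<omega>. \<phi> (X \<omega>) * W n \<omega> \<partial>M)" for n
    using ibp[of n] d c b unfolding ibp_pair_def by blast
  ultimately show "(\<integral>\<omega>. \<phi>' (X \<omega>) * R' \<omega> \<partial>M) = - (\<integral>\<omega>. \<phi> (X \<omega>) * W' \<omega> \<partial>M)"
    by (simp add: LIMSEQ_unique)
qed

text \<open>The test function \<open>(\<bar>y - a\<bar> - \<bar>y - b\<bar>) / 2\<close> is smoothed by replacing \<open>\<bar>t\<bar>\<close> with
  \<open>sqrt (t\<^sup>2 + \<delta>\<^sup>2)\<close>.\<close>

lemma ibp_pair_abs:
  assumes ibp: "ibp_pair M X R W" and [measurable]: "X \<in> borel_measurable M"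
  shows "(\<integral>\<omega>. (sgn (X \<omega> - a) - sgn (X \<omega> - b)) * R \<omega> \<partial>M) =
         (\<integral>\<omega>. (\<bar>X \<omega> - b\<bar> - \<bar>X \<omega> - a\<bar>) * W \<omega> \<partial>M)"
proof -
  \<comment> \<open>\<open>d n\<close> is the square of the smoothing parameter \<delta>; the
    successor keeps it positive at \<open>n = 0\<close>.\<close>
  define d where "d n = (1 / real (Suc n))\<^sup>2" for n
  have dpos: "d n > 0" for n by (simp add: d_def)
  have dlim: "d \<longlonglongrightarrow> 0"
    unfolding d_def using LIMSEQ_Suc[OF lim_1_over_n] by (auto intro!: tendsto_eq_intros)
  define s where "s n t = sqrt (t\<^sup>2 + d n)" for n and t :: real
  have spos: "s n t > 0" for n t
    using dpos[of n] by (simp add: s_def add_nonneg_pos)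
  have sge: "\<bar>t\<bar> \<le> s n t" for n t
    unfolding s_def using dpos[of n] by (intro real_le_rsqrt) auto
  have sd: "((s n) has_real_derivative t / s n t) (at t)" for n t
    unfolding s_def using dpos[of n] add_nonneg_pos[of "t\<^sup>2" "d n"]
    by (auto intro!: derivative_eq_intros simp: field_simps)
  \<comment> \<open>The smoothed absolute value alone is unbounded. Being 1-Lipschitz, its
    translates by \<open>a\<close> and \<open>b\<close> differ by at most
    \<open>\<bar>b - a\<bar>\<close>, which makes the test function bounded and gives the dominating
    constant.\<close>
  have slip: "\<bar>s n x - s n y\<bar> \<le> \<bar>x - y\<bar>" for n x y
  proof -
    have "\<bar>s n x - s n y\<bar> * (s n x + s n y) = \<bar>(s n x)\<^sup>2 - (s n y)\<^sup>2\<bar>"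
      using spos[of n x] spos[of n y] by (simp add: power2_eq_square square_diff_square_factored abs_mult)
    also have "\<dots> = \<bar>x - y\<bar> * \<bar>x + y\<bar>"
      using dpos[of n] by (simp add: s_def add_nonneg_nonneg abs_mult[symmetric] power2_eq_square algebra_simps)
    also have "\<dots> \<le> \<bar>x - y\<bar> * (s n x + s n y)"
      using sge[of x n] sge[of y n] by (intro mult_left_mono) auto
    finally show ?thesis
      using spos[of n x] spos[of n y] by (simp add: mult_le_cancel_right)
  qed
  have slim: "(\<lambda>n. s n t) \<longlonglongrightarrow> \<bar>t\<bar>" for t
    unfolding s_def using dlim by (auto intro!: tendsto_eq_intros)
  \<comment> \<open>At \<open>t = 0\<close> the quotient is 0, in agreement with
    \<open>sgn 0 = 0\<close>. The convergence thus holds everywhere, and atoms of \<open>X\<close>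
    do no harm at this stage.\<close>
  have sdlim: "(\<lambda>n. t / s n t) \<longlonglongrightarrow> sgn t" for t
  proof (cases "t = 0")
    case False
    then have "(\<lambda>n. t / s n t) \<longlonglongrightarrow> t / \<bar>t\<bar>"
      by (intro tendsto_intros slim) auto
    then show ?thesis using False by (simp add: sgn_if abs_if split: if_splits)
  qed auto
  have sdle: "\<bar>t / s n t\<bar> \<le> 1" for n t
    using sge[of t n] spos[of n t] by (simp add: abs_div)
  have scont: "continuous_on UNIV (s n)" for n
    by (rule DERIV_continuous_on[OF has_field_derivative_at_within[OF sd]])
  have eq: "(\<integral>\<omega>. ((X \<omega> - a) / s n (X \<omega> - a) - (X \<omega> - b) / s n (X \<omega> - b)) * R \<omega> \<partial>M) =
        - (\<integral>\<omega>. (s n (X \<omega> - a) - s n (X \<omega> - b)) * W \<omega> \<partial>M)" for n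
  proof -
    let ?p = "\<lambda>y. s n (y - a) - s n (y - b)"
    let ?q = "\<lambda>y. (y - a) / s n (y - a) - (y - b) / s n (y - b)"
    have "\<And>x. (?p has_real_derivative ?q x) (at x)"
      by (auto intro!: derivative_eq_intros DERIV_chain2[OF sd])
    moreover have "continuous_on UNIV ?q"
      using spos[of n] by (intro continuous_intros continuous_on_compose2[OF scont]) (auto simp: less_imp_neq[symmetric])
    moreover have "bounded (range ?p)"
      using slip[of n] by (auto simp: bounded_iff intro!: exI[of _ "\<bar>b - a\<bar>"] order_trans[OF slip])
    moreover have "bounded (range ?q)"
      using order_trans[OF abs_triangle_ineq4 add_mono[OF sdle sdle]]
      unfolding bounded_iff real_norm_def by blast
    ultimately show ?thesis
      by (rule ibp_pairD[OF ibp, of ?p ?q])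
  qed
  have [measurable]: "s n \<in> borel_measurable borel" for n
    using scont by (auto intro: borel_measurable_continuous_onI)
  have "(\<lambda>n. \<integral>\<omega>. ((X \<omega> - a) / s n (X \<omega> - a) - (X \<omega> - b) / s n (X \<omega> - b)) * R \<omega> \<partial>M)
     \<longlonglongrightarrow> (\<integral>\<omega>. (sgn (X \<omega> - a) - sgn (X \<omega> - b)) * R \<omega> \<partial>M)"
  proof (rule tendsto_integral_bounded_mult[where B = 2])
    show "\<bar>(X \<omega> - a) / s n (X \<omega> - a) - (X \<omega> - b) / s n (X \<omega> - b)\<bar> \<le> 2" for n \<omega>
      using sdle[of "X \<omega> - a" n] sdle[of "X \<omega> - b" n] by linarith
  qed (use ibp in \<open>auto simp: ibp_pair_def intro!: tendsto_diff sdlim\<close>)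
  moreover have "(\<lambda>n. - (\<integral>\<omega>. (s n (X \<omega> - a) - s n (X \<omega> - b)) * W \<omega> \<partial>M))
     \<longlonglongrightarrow> - (\<integral>\<omega>. (\<bar>X \<omega> - a\<bar> - \<bar>X \<omega> - b\<bar>) * W \<omega> \<partial>M)"
  proof (intro tendsto_minus tendsto_integral_bounded_mult[where B = "\<bar>b - a\<bar>"])
    show "\<bar>s n (X \<omega> - a) - s n (X \<omega> - b)\<bar> \<le> \<bar>b - a\<bar>" for n \<omega>
      using slip[of n "X \<omega> - a" "X \<omega> - b"] by simp
  qed (use ibp in \<open>auto simp: ibp_pair_def intro!: tendsto_diff slim\<close>)
  ultimately have "(\<integral>\<omega>. (sgn (X \<omega> - a) - sgn (X \<omega> - b)) * R \<omega> \<partial>M) =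
      - (\<integral>\<omega>. (\<bar>X \<omega> - a\<bar> - \<bar>X \<omega> - b\<bar>) * W \<omega> \<partial>M)"
    unfolding eq by (rule LIMSEQ_unique)
  also have "\<dots> = (\<integral>\<omega>. - ((\<bar>X \<omega> - a\<bar> - \<bar>X \<omega> - b\<bar>) * W \<omega>) \<partial>M)"
    by simp
  finally show ?thesis
    by (simp add: algebra_simps)
qed

section \<open>Absence of atoms and the density of the weighted law\<close>

text \<open>For \<open>a < c < b\<close> the difference of signs is 2 at \<open>c\<close> and
  nowhere negative, so the mass that \<open>R\<close> gives to \<open>X = c\<close> is at most the
  right side of \<open>ibp_pair_abs\<close>. That side vanishes as \<open>a\<close> and
  \<open>b\<close> approach \<open>c\<close>, and strict positivity of \<open>R\<close> makes the
  event null.\<close>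

lemma ibp_pair_no_atoms:
  assumes ibp: "ibp_pair M X R W" and [measurable]: "X \<in> borel_measurable M"
    and R: "AE \<omega> in M. 0 < R \<omega>"
  shows "AE \<omega> in M. X \<omega> \<noteq> c"
proof -
  have int: "integrable M R" "integrable M W" using ibp by (auto simp: ibp_pair_def)
  note [measurable] = borel_measurable_integrable[OF int(1)]
  define a where "a n = c - 1 / real (Suc n)" for n
  define b where "b n = c + 1 / real (Suc n)" for n
  have lims: "a \<longlonglongrightarrow> c" "b \<longlonglongrightarrow> c"
    using tendsto_diff[OF tendsto_const LIMSEQ_Suc[OF lim_1_over_n], of c]
      tendsto_add[OF tendsto_const LIMSEQ_Suc[OF lim_1_over_n], of c]
    unfolding a_def b_def by simp_all
  have "1 / real (Suc n) \<le> 1" for n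
    by simp
  then have ab: "a n < c" "c < b n" "b n - a n \<le> 2" for n
    using add_mono[of "1 / real (Suc n)" 1 "1 / real (Suc n)" 1] by (auto simp: a_def b_def)
  have le: "(\<integral>\<omega>. indicator {c} (X \<omega>) * R \<omega> \<partial>M) \<le> (\<integral>\<omega>. (\<bar>X \<omega> - b n\<bar> - \<bar>X \<omega> - a n\<bar>) * W \<omega> \<partial>M)" for n
  proof -
    have "(\<integral>\<omega>. indicator {c} (X \<omega>) * R \<omega> \<partial>M) \<le> (\<integral>\<omega>. (sgn (X \<omega> - a n) - sgn (X \<omega> - b n)) * R \<omega> \<partial>M)"
    proof (rule integral_mono_AE)
      show "integrable M (\<lambda>\<omega>. indicator {c} (X \<omega>) * R \<omega>)"
        using int by (intro integrable_bounded_mult[where B = 1]) auto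
      show "integrable M (\<lambda>\<omega>. (sgn (X \<omega> - a n) - sgn (X \<omega> - b n)) * R \<omega>)"
        using int by (intro integrable_bounded_mult[where B = 2]) (auto simp: sgn_if)
      show "AE \<omega> in M. indicator {c} (X \<omega>) * R \<omega> \<le> (sgn (X \<omega> - a n) - sgn (X \<omega> - b n)) * R \<omega>"
        using R by eventually_elim (use ab[of n] in \<open>auto simp: sgn_if indicator_def\<close>)
    qed
    then show ?thesis by (simp add: ibp_pair_abs[OF ibp])
  qed
  have "(\<lambda>n. \<integral>\<omega>. (\<bar>X \<omega> - b n\<bar> - \<bar>X \<omega> - a n\<bar>) * W \<omega> \<partial>M) \<longlonglongrightarrow> (\<integral>\<omega>. 0 * W \<omega> \<partial>M)"
  proof (rule tendsto_integral_bounded_mult[where B = 2])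
    show "\<bar>\<bar>X \<omega> - b n\<bar> - \<bar>X \<omega> - a n\<bar>\<bar> \<le> 2" for n \<omega>
      using ab[of n] by linarith
    show "AE \<omega> in M. (\<lambda>n. \<bar>X \<omega> - b n\<bar> - \<bar>X \<omega> - a n\<bar>) \<longlonglongrightarrow> 0"
      using lims by (auto intro!: tendsto_eq_intros)
  qed (use int in auto)
  then have "(\<integral>\<omega>. indicator {c} (X \<omega>) * R \<omega> \<partial>M) \<le> 0"
    using le by (intro LIMSEQ_le_const) auto
  moreover have nn: "AE \<omega> in M. 0 \<le> indicator {c} (X \<omega>) * R \<omega>"
    using R by eventually_elim auto
  moreover have i: "integrable M (\<lambda>\<omega>. indicator {c} (X \<omega>) * R \<omega>)"
    using int by (intro integrable_bounded_mult[where B = 1]) auto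
  ultimately have "(\<integral>\<omega>. indicator {c} (X \<omega>) * R \<omega> \<partial>M) = 0"
    using integral_nonneg_AE[OF nn] by linarith
  \<comment> \<open>A nonnegative integrand with integral 0 vanishes almost surely; where
    \<open>R\<close> is positive, the indicator must be the factor that vanishes.\<close>
  then have "AE \<omega> in M. indicator {c} (X \<omega>) * R \<omega> = 0"
    using integral_nonneg_eq_0_iff_AE[OF i nn] by simp
  then show ?thesis
    using R by eventually_elim (auto simp: indicator_def)
qed

text \<open>Absence of atoms is assumed here instead of being derived from \<open>R\<close>, because
  the results are also applied to differences of weights, which are known only to be
  nonnegative.\<close>

context
  fixes M :: "'a measure" and X R W :: "'a \<Rightarrow> real"
  assumes ibp: "ibp_pair M X R W" and X[measurable]: "X \<in> borel_measurable M"
    and no_atoms: "\<And>c. AE \<omega> in M. X \<omega> \<noteq> c"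
begin

lemma integrable_weights: "integrable M R" "integrable M W"
  using ibp by (auto simp: ibp_pair_def)

text \<open>The sign jumps only on the event \<open>X = x\<close>, which is null, so dominated
  convergence applies with the bound 1.\<close>

lemma ibp_pair_continuous: "continuous_on UNIV (sign_mean M X W)"
proof (rule continuous_at_imp_continuous_on, intro ballI, unfold continuous_at_sequentially, intro allI impI)
  fix x and y :: "nat \<Rightarrow> real" assume y: "y \<longlonglongrightarrow> x"
  have "(\<lambda>n. \<integral>\<omega>. sgn (y n - X \<omega>) * W \<omega> \<partial>M) \<longlonglongrightarrow> (\<integral>\<omega>. sgn (x - X \<omega>) * W \<omega> \<partial>M)"
  proof (rule tendsto_integral_bounded_mult[where B = 1])
    show "AE \<omega> in M. (\<lambda>n. sgn (y n - X \<omega>)) \<longlonglongrightarrow> sgn (x - X \<omega>)"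
      using no_atoms[of x] by eventually_elim (use y in \<open>auto intro!: tendsto_intros\<close>)
  qed (auto simp: sgn_if integrable_weights)
  then show "(sign_mean M X W \<circ> y) \<longlonglongrightarrow> sign_mean M X W x"
    unfolding sign_mean_def comp_def by (intro tendsto_intros)
qed

text \<open>Up to atoms, \<open>(1 + sgn (X - t)) / 2\<close> is the indicator of \<open>X > t\<close>; its increments in \<open>t\<close> are rewritten
  by \<open>ibp_pair_abs\<close> before differentiating, so that only \<open>\<bar>X - t\<bar>\<close> has to be differentiated.\<close>

lemma ibp_pair_deriv:
  "((\<lambda>t. - (\<integral>\<omega>. (1 + sgn (X \<omega> - t)) * R \<omega> \<partial>M) / 2) has_real_derivative sign_mean M X W t) (at t)"
proof -
  let ?V = "\<lambda>t. - (\<integral>\<omega>. (1 + sgn (X \<omega> - t)) * R \<omega> \<partial>M) / 2"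
  have int: "integrable M (\<lambda>\<omega>. (1 + sgn (X \<omega> - t)) * R \<omega>)" for t
    by (intro integrable_bounded_mult[where B = 2]) (auto simp: sgn_if integrable_weights)
  have eq: "?V s - ?V t = (\<integral>\<omega>. (\<bar>X \<omega> - s\<bar> - \<bar>X \<omega> - t\<bar>) * W \<omega> \<partial>M) / 2" for s t
  proof -
    have "?V s - ?V t = (\<integral>\<omega>. (1 + sgn (X \<omega> - t)) * R \<omega> - (1 + sgn (X \<omega> - s)) * R \<omega> \<partial>M) / 2"
      by (subst Bochner_Integration.integral_diff[OF int int]) simp
    also have "\<dots> = (\<integral>\<omega>. (sgn (X \<omega> - t) - sgn (X \<omega> - s)) * R \<omega> \<partial>M) / 2"
      by (simp add: algebra_simps)
    finally show ?thesis by (simp add: ibp_pair_abs[OF ibp])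
  qed
  show ?thesis
    unfolding has_field_derivative_iff tendsto_at_iff_sequentially comp_def
  proof (intro allI impI)
    fix y :: "nat \<Rightarrow> real" assume yne: "\<forall>i. y i \<in> UNIV - {t}" and y: "y \<longlonglongrightarrow> t"
    have "(\<lambda>n. \<integral>\<omega>. ((\<bar>X \<omega> - y n\<bar> - \<bar>X \<omega> - t\<bar>) / (y n - t)) * W \<omega> \<partial>M)
        \<longlonglongrightarrow> (\<integral>\<omega>. sgn (t - X \<omega>) * W \<omega> \<partial>M)"
    proof (rule tendsto_integral_bounded_mult[where B = 1])
      show "\<bar>(\<bar>X \<omega> - y n\<bar> - \<bar>X \<omega> - t\<bar>) / (y n - t)\<bar> \<le> 1" for n \<omega>
      proof -
        have "y n - t \<noteq> 0" using yne by auto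
        moreover have "\<bar>\<bar>X \<omega> - y n\<bar> - \<bar>X \<omega> - t\<bar>\<bar> \<le> \<bar>y n - t\<bar>" by linarith
        ultimately show ?thesis by (simp add: abs_div)
      qed
      show "AE \<omega> in M. (\<lambda>n. (\<bar>X \<omega> - y n\<bar> - \<bar>X \<omega> - t\<bar>) / (y n - t)) \<longlonglongrightarrow> sgn (t - X \<omega>)"
        using no_atoms[of t]
      proof eventually_elim
        case (elim \<omega>)
        \<comment> \<open>Once \<open>y n\<close> is closer to \<open>t\<close> than
          \<open>X \<omega>\<close> is, both points lie on the same side of
          \<open>X \<omega>\<close>. There the absolute value is affine and the quotient equals its
          limit exactly.\<close>
        have "eventually (\<lambda>n. \<bar>y n - t\<bar> < \<bar>X \<omega> - t\<bar>) sequentially"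
          using y elim by (auto simp: tendsto_iff dist_real_def)
        then have "eventually (\<lambda>n. (\<bar>X \<omega> - y n\<bar> - \<bar>X \<omega> - t\<bar>) / (y n - t) = sgn (t - X \<omega>)) sequentially"
        proof eventually_elim
          case (elim n)
          have "y n - t \<noteq> 0" using yne by auto
          moreover have "\<bar>X \<omega> - y n\<bar> - \<bar>X \<omega> - t\<bar> = sgn (t - X \<omega>) * (y n - t)"
            using elim by (auto simp: sgn_if abs_if split: if_splits)
          ultimately show ?case by simp
        qed
        then show ?case by (rule tendsto_eventually)
      qed
    qed (auto simp: integrable_weights)
    then have "(\<lambda>n. 1 / 2 * (\<integral>\<omega>. ((\<bar>X \<omega> - y n\<bar> - \<bar>X \<omega> - t\<bar>) / (y n - t)) * W \<omega> \<partial>M))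
        \<longlonglongrightarrow> sign_mean M X W t"
      unfolding sign_mean_def by (intro tendsto_intros)
    then show "(\<lambda>n. (?V (y n) - ?V t) / (y n - t)) \<longlonglongrightarrow> sign_mean M X W t"
      unfolding eq by (simp add: field_simps)
  qed
qed

context
  assumes nonneg: "AE \<omega> in M. 0 \<le> R \<omega>"
begin

text \<open>By \<open>ibp_pair_deriv\<close> this is the derivative of minus the mass that
  \<open>R\<close> gives to \<open>X > t\<close>, which is nondecreasing in \<open>t\<close> when
  \<open>R\<close> is nonnegative.\<close>

lemma ibp_pair_nonneg: "0 \<le> sign_mean M X W t"
proof (rule mono_on_imp_deriv_nonneg[where A = UNIV])
  show "mono_on UNIV (\<lambda>t. - (\<integral>\<omega>. (1 + sgn (X \<omega> - t)) * R \<omega> \<partial>M) / 2)"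
  proof (rule mono_onI)
    fix r s :: real assume "r \<le> s"
    have "(\<integral>\<omega>. (1 + sgn (X \<omega> - s)) * R \<omega> \<partial>M) \<le> (\<integral>\<omega>. (1 + sgn (X \<omega> - r)) * R \<omega> \<partial>M)"
    proof (rule integral_mono_AE)
      show "AE \<omega> in M. (1 + sgn (X \<omega> - s)) * R \<omega> \<le> (1 + sgn (X \<omega> - r)) * R \<omega>"
        using nonneg by eventually_elim (use \<open>r \<le> s\<close> in \<open>auto intro!: mult_right_mono simp: sgn_if\<close>)
    qed (auto intro!: integrable_bounded_mult[where B = 2] simp: sgn_if integrable_weights)
    then show "- (\<integral>\<omega>. (1 + sgn (X \<omega> - r)) * R \<omega> \<partial>M) / 2 \<le> - (\<integral>\<omega>. (1 + sgn (X \<omega> - s)) * R \<omega> \<partial>M) / 2"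
      by simp
  qed
  show "((\<lambda>t. - (\<integral>\<omega>. (1 + sgn (X \<omega> - t)) * R \<omega> \<partial>M) / 2) has_real_derivative
      sign_mean M X W t) (at t)"
    by (rule ibp_pair_deriv)
qed auto

text \<open>Both measures are compared on the half-lines \<open>{t<..}\<close>. The left one has the
  antiderivative of \<open>ibp_pair_deriv\<close> as its tail, up to sign; the right one is computed
  by the fundamental theorem of calculus on \<open>[t, \<infinity>)\<close>.\<close>

lemma ibp_pair_distr:
  "distr (density M (\<lambda>\<omega>. ennreal (R \<omega>))) borel X = density lborel (\<lambda>x. ennreal (sign_mean M X W x))"
proof (rule measure_eqI_lessThan)
  note [measurable] = borel_measurable_integrable[OF integrable_weights(1)]
    borel_measurable_continuous_onI[OF ibp_pair_continuous]
  let ?V = "\<lambda>t. - (\<integral>\<omega>. (1 + sgn (X \<omega> - t)) * R \<omega> \<partial>M) / 2"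
  have half: "emeasure (distr (density M (\<lambda>\<omega>. ennreal (R \<omega>))) borel X) {t<..} = ennreal (- ?V t)" for t
  proof -
    have "emeasure (distr (density M (\<lambda>\<omega>. ennreal (R \<omega>))) borel X) {t<..} =
        (\<integral>\<^sup>+\<omega>. ennreal (R \<omega>) * indicator (X -` {t<..} \<inter> space M) \<omega> \<partial>M)"
      by (subst emeasure_distr) (auto intro!: emeasure_density)
    \<comment> \<open>On \<open>X = t\<close> the right factor is 1/2 whereas the indicator is 0;
      this event is null.\<close>
    also have "\<dots> = (\<integral>\<^sup>+\<omega>. ennreal ((1 + sgn (X \<omega> - t)) * R \<omega> / 2) \<partial>M)"
      using no_atoms[of t] AE_space by (intro nn_integral_cong_AE, eventually_elim)
        (auto simp: indicator_def sgn_if)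
    also have "\<dots> = ennreal (\<integral>\<omega>. (1 + sgn (X \<omega> - t)) * R \<omega> / 2 \<partial>M)"
    proof (rule nn_integral_eq_integral)
      show "integrable M (\<lambda>\<omega>. (1 + sgn (X \<omega> - t)) * R \<omega> / 2)"
        by (auto intro!: integrable_bounded_mult[where B = 2] simp: sgn_if integrable_weights)
      show "AE \<omega> in M. 0 \<le> (1 + sgn (X \<omega> - t)) * R \<omega> / 2"
        using nonneg by eventually_elim (auto simp: sgn_if)
    qed
    finally show ?thesis by simp
  qed
  show "emeasure (distr (density M (\<lambda>\<omega>. ennreal (R \<omega>))) borel X) {t<..} < \<infinity>" for t
    by (simp add: half)
  show "emeasure (distr (density M (\<lambda>\<omega>. ennreal (R \<omega>))) borel X) {t<..} =
      emeasure (density lborel (\<lambda>x. ennreal (sign_mean M X W x))) {t<..}" for t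
  proof -
    \<comment> \<open>This fixes the constant of integration: for each outcome the factor
      \<open>1 + sgn (X \<omega> - y n)\<close> is 0 as soon as \<open>y n\<close> exceeds
      \<open>X \<omega>\<close>.\<close>
    have lim: "(?V \<longlongrightarrow> 0) at_top"
    proof (rule tendsto_at_topI_sequentially)
      fix y :: "nat \<Rightarrow> real" assume y: "filterlim y at_top sequentially"
      have "(\<lambda>n. \<integral>\<omega>. (1 + sgn (X \<omega> - y n)) * R \<omega> \<partial>M) \<longlonglongrightarrow> (\<integral>\<omega>. 0 * R \<omega> \<partial>M)"
      proof (rule tendsto_integral_bounded_mult[where B = 2])
        show "AE \<omega> in M. (\<lambda>n. 1 + sgn (X \<omega> - y n)) \<longlonglongrightarrow> 0"
        proof (rule AE_I2)
          fix \<omega>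
          have "eventually (\<lambda>n. X \<omega> < y n) sequentially"
            using y by (auto simp: filterlim_at_top_dense)
          then have "eventually (\<lambda>n. 1 + sgn (X \<omega> - y n) = 0) sequentially"
            by eventually_elim auto
          then show "(\<lambda>n. 1 + sgn (X \<omega> - y n)) \<longlonglongrightarrow> 0" by (rule tendsto_eventually)
        qed
      qed (auto simp: sgn_if integrable_weights)
      then show "(\<lambda>n. ?V (y n)) \<longlonglongrightarrow> 0"
        by (auto intro!: tendsto_eq_intros)
    qed
    have "emeasure (density lborel (\<lambda>x. ennreal (sign_mean M X W x))) {t<..} =
        (\<integral>\<^sup>+x. ennreal (sign_mean M X W x) * indicator {t<..} x \<partial>lborel)"
      by (auto intro!: emeasure_density)
    also have "\<dots> = (\<integral>\<^sup>+x. ennreal (sign_mean M X W x) * indicator {t..} x \<partial>lborel)"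
      using AE_lborel_singleton[of t] by (intro nn_integral_cong_AE, eventually_elim)
        (auto simp: indicator_def)
    also have "\<dots> = ennreal (0 - ?V t)"
      by (rule nn_integral_FTC_atLeast[OF _ ibp_pair_deriv ibp_pair_nonneg lim]) measurable
    finally show ?thesis using half[of t] by simp
  qed
qed auto

end

end

section \<open>Functional calculus in one and two variables\<close>

lemma abs_le_L2_set:
  assumes "finite A" "i \<in> A"
  shows "\<bar>f i\<bar> \<le> L2_set f A"
  using member_le_L2_set[OF assms, of "\<lambda>i. \<bar>f i\<bar>"] by (simp add: L2_set_def)

lemma continuous_map_Euclidean_space_component:
  "continuous_map (Euclidean_space m) euclideanreal (\<lambda>y. y i)"
  unfolding Euclidean_space_def
  by (intro continuous_map_from_subtopology continuous_map_product_projection) auto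

lemma continuous_map_Euclidean_space_compose:
  assumes "continuous_on UNIV (f :: real \<Rightarrow> real)"
  shows "continuous_map (Euclidean_space m) euclideanreal (\<lambda>y. f (y i))"
  using continuous_map_compose[OF continuous_map_Euclidean_space_component, of euclideanreal f m i] assms
  by (simp add: comp_def)

lemma lipschitz_of_bounded_deriv:
  fixes h :: "real \<Rightarrow> real"
  assumes d: "\<And>x. (h has_real_derivative h' x) (at x)" and b: "\<And>x. \<bar>h' x\<bar> \<le> C"
  shows "\<bar>h x - h y\<bar> \<le> C * \<bar>x - y\<bar>"
  using field_differentiable_bound[of UNIV h h' C x y] d b by simp

lemma has_field_derivative_imp_differentiable: "(f has_real_derivative l) (at x) \<Longrightarrow> f differentiable at x"
  by (auto simp: real_differentiable_def)

lemma partial_deriv_1: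
  assumes "\<And>x. (h has_real_derivative h' x) (at x)"
  shows "partial_deriv (\<lambda>y. h (y 0)) 0 = (\<lambda>y. h' (y 0))"
  unfolding partial_deriv_def by (auto intro!: DERIV_imp_deriv assms)

lemma C1_Lipschitz_1:
  assumes d: "\<And>x. (h has_real_derivative h' x) (at x)" and c: "continuous_on UNIV h'"
    and b: "\<And>x. \<bar>h' x\<bar> \<le> C"
  shows "C1_fun 1 (\<lambda>y. h (y 0))" "Lipschitz_fun 1 (\<lambda>y. h (y 0))"
proof -
  show "C1_fun 1 (\<lambda>y. h (y 0))"
    unfolding C1_fun_def using d partial_deriv_1[of h h', OF d]
    by (auto intro!: continuous_map_Euclidean_space_compose c has_field_derivative_imp_differentiable)
  have "\<bar>h (x 0) - h (y 0)\<bar> \<le> C * L2_set (\<lambda>i. x i - y i) {..<1}" for x y :: "nat \<Rightarrow> real"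
  proof -
    have "C \<ge> 0" using b[of 0] by linarith
    then show ?thesis
      using order_trans[OF lipschitz_of_bounded_deriv[of h h' C, OF d b]
          mult_left_mono[OF abs_le_L2_set[of "{..<1}" 0 "\<lambda>i. x i - y i"]]]
      by simp
  qed
  then show "Lipschitz_fun 1 (\<lambda>y. h (y 0))"
    unfolding Lipschitz_fun_def by blast
qed

text \<open>The calculus for \<Gamma> expects a function of a tuple in both arguments. A plain
  second argument \<open>v\<close> is presented as the identity applied to a tuple of length
  1.\<close>

lemma identity_C1_Lipschitz:
  "C1_fun 1 (\<lambda>y :: nat \<Rightarrow> real. y 0)" "Lipschitz_fun 1 (\<lambda>y :: nat \<Rightarrow> real. y 0)"
  "partial_deriv (\<lambda>y :: nat \<Rightarrow> real. y 0) 0 = (\<lambda>_. 1)"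
  using C1_Lipschitz_1[of "\<lambda>x. x" "\<lambda>_. 1" 1] partial_deriv_1[of "\<lambda>x. x" "\<lambda>_. 1"] by auto

lemma partial_deriv_mult:
  assumes "\<And>x. (f has_real_derivative f' x) (at x)" "\<And>x. (h has_real_derivative h' x) (at x)"
  shows "partial_deriv (\<lambda>y. f (y 0) * h (y 1)) 0 = (\<lambda>y. f' (y 0) * h (y 1))"
    and "partial_deriv (\<lambda>y. f (y 0) * h (y 1)) 1 = (\<lambda>y. f (y 0) * h' (y 1))"
  unfolding partial_deriv_def
  by (auto intro!: DERIV_imp_deriv derivative_eq_intros assms)

text \<open>A product of two Lipschitz functions is not Lipschitz in general. Boundedness of both
  factors repairs this: changing one variable at a time gives the constant
  \<open>B' * C + B * C'\<close>.\<close>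

lemma C1_Lipschitz_mult:
  assumes f: "\<And>x. (f has_real_derivative f' x) (at x)" "continuous_on UNIV f'"
      "\<And>x. \<bar>f x\<bar> \<le> B" "\<And>x. \<bar>f' x\<bar> \<le> B'"
    and h: "\<And>x. (h has_real_derivative h' x) (at x)" "continuous_on UNIV h'"
      "\<And>x. \<bar>h x\<bar> \<le> C" "\<And>x. \<bar>h' x\<bar> \<le> C'"
  shows "C1_fun 2 (\<lambda>y. f (y 0) * h (y 1))" "Lipschitz_fun 2 (\<lambda>y. f (y 0) * h (y 1))"
proof -
  let ?F = "\<lambda>y :: nat \<Rightarrow> real. f (y 0) * h (y 1)"
  note pd = partial_deriv_mult[of f f' h h', OF f(1) h(1)]
  have cont: "continuous_on UNIV f" "continuous_on UNIV h"
    by (rule DERIV_continuous_on[OF has_field_derivative_at_within[OF f(1)]],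
        rule DERIV_continuous_on[OF has_field_derivative_at_within[OF h(1)]])
  have "(\<lambda>t. ?F (x(i := t))) differentiable at (x i) \<and>
      continuous_map (Euclidean_space 2) euclideanreal (partial_deriv ?F i)" if "i < 2" for i x
  proof (cases "i = 0")
    case True
    have "((\<lambda>t. ?F (x(0 := t))) has_real_derivative f' (x 0) * h (x 1)) (at (x 0))"
      using DERIV_mult[OF f(1) DERIV_const] by simp
    then show ?thesis
      unfolding True pd
      by (intro conjI has_field_derivative_imp_differentiable continuous_map_real_mult
          continuous_map_Euclidean_space_compose f(2) cont(2))
  next
    case False
    then have "i = 1" using that by auto
    moreover have "((\<lambda>t. ?F (x(1 := t))) has_real_derivative f (x 0) * h' (x 1)) (at (x 1))"
      using DERIV_cmult[OF h(1)] by simp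
    ultimately show ?thesis
      by (simp only: pd) (intro conjI has_field_derivative_imp_differentiable continuous_map_real_mult
          continuous_map_Euclidean_space_compose h(2) cont(1), simp)
  qed
  then show "C1_fun 2 ?F"
    unfolding C1_fun_def by blast
  have pos: "B \<ge> 0" "B' \<ge> 0" "C \<ge> 0" "C' \<ge> 0"
    using f(3,4)[of 0] h(3,4)[of 0] by linarith+
  have "\<bar>?F x - ?F y\<bar> \<le> (B' * C + B * C') * L2_set (\<lambda>i. x i - y i) {..<2}" for x y :: "nat \<Rightarrow> real"
  proof -
    let ?l = "L2_set (\<lambda>i. x i - y i) {..<2}"
    have l: "\<bar>x 0 - y 0\<bar> \<le> ?l" "\<bar>x 1 - y 1\<bar> \<le> ?l"
      using abs_le_L2_set[of "{..<2}" _ "\<lambda>i. x i - y i"] by auto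
    have "\<bar>f (x 0) - f (y 0)\<bar> \<le> B' * ?l" "\<bar>h (x 1) - h (y 1)\<bar> \<le> C' * ?l"
      using order_trans[OF lipschitz_of_bounded_deriv[of f f' B', OF f(1,4)] mult_left_mono[OF l(1) pos(2)]]
        order_trans[OF lipschitz_of_bounded_deriv[of h h' C', OF h(1,4)] mult_left_mono[OF l(2) pos(4)]]
      by auto
    then have "\<bar>f (x 0) - f (y 0)\<bar> * \<bar>h (x 1)\<bar> + \<bar>f (y 0)\<bar> * \<bar>h (x 1) - h (y 1)\<bar>
        \<le> (B' * ?l) * C + B * (C' * ?l)"
      using f(3)[of "y 0"] h(3)[of "x 1"] pos by (intro add_mono mult_mono) auto
    moreover have "?F x - ?F y = (f (x 0) - f (y 0)) * h (x 1) + f (y 0) * (h (x 1) - h (y 1))"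
      by (simp add: algebra_simps)
    then have "\<bar>?F x - ?F y\<bar> \<le> \<bar>f (x 0) - f (y 0)\<bar> * \<bar>h (x 1)\<bar> + \<bar>f (y 0)\<bar> * \<bar>h (x 1) - h (y 1)\<bar>"
      unfolding abs_mult[symmetric] by (metis abs_triangle_ineq)
    ultimately show ?thesis by (simp add: algebra_simps)
  qed
  then show "Lipschitz_fun 2 ?F"
    unfolding Lipschitz_fun_def by blast
qed

context error_structure
begin

lemma domain_measurable: "u \<in> D \<Longrightarrow> u \<in> borel_measurable M"
  using domain_subspace by (auto simp: L2_subspace_def L2_def)

lemma domain_square_integrable: "u \<in> D \<Longrightarrow> integrable M (\<lambda>\<omega>. (u \<omega>)\<^sup>2)"
  using domain_subspace by (auto simp: L2_subspace_def L2_def)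

lemma domain_cong:
  "\<lbrakk>u \<in> D; v \<in> borel_measurable M; AE \<omega> in M. u \<omega> = v \<omega>\<rbrakk> \<Longrightarrow> v \<in> D"
  using domain_subspace unfolding L2_subspace_def by blast

lemma Gamma_chain:
  assumes u: "u \<in> D" and v: "v \<in> D"
    and h: "\<And>x. (h has_real_derivative h' x) (at x)" "continuous_on UNIV h'" "\<And>x. \<bar>h' x\<bar> \<le> C"
  shows "(\<lambda>\<omega>. h (u \<omega>)) \<in> D"
    and "AE \<omega> in M. \<Gamma> (\<lambda>\<omega>. h (u \<omega>)) v \<omega> = h' (u \<omega>) * \<Gamma> u v \<omega>"
proof -
  note cl = C1_Lipschitz_1[of h h' C, OF h]
  show "(\<lambda>\<omega>. h (u \<omega>)) \<in> D"
    using calculus_domain[of 1 "\<lambda>_. u", OF _ cl] u by (simp add: tuple_def)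
  show "AE \<omega> in M. \<Gamma> (\<lambda>\<omega>. h (u \<omega>)) v \<omega> = h' (u \<omega>) * \<Gamma> u v \<omega>"
    using calculus_Gamma[of 1 "\<lambda>_. u" "\<lambda>y. h (y 0)" 1 "\<lambda>_. v" "\<lambda>y. y 0", OF _ cl _ identity_C1_Lipschitz(1,2)] u v
    by (simp add: tuple_def identity_C1_Lipschitz partial_deriv_1[of h h', OF h(1)])
qed

text \<open>The product is treated as one function of the pair \<open>(u, w)\<close>, so that the
  functional calculus places it in the domain without \<open>D\<close> having to be closed under
  products.\<close>

lemma Gamma_product:
  assumes u: "u \<in> D" and w: "w \<in> D" and v: "v \<in> D"
    and f: "\<And>x. (f has_real_derivative f' x) (at x)" "continuous_on UNIV f'"
      "\<And>x. \<bar>f x\<bar> \<le> B" "\<And>x. \<bar>f' x\<bar> \<le> B'"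
    and h: "\<And>x. (h has_real_derivative h' x) (at x)" "continuous_on UNIV h'"
      "\<And>x. \<bar>h x\<bar> \<le> C" "\<And>x. \<bar>h' x\<bar> \<le> C'"
  shows "(\<lambda>\<omega>. f (u \<omega>) * h (w \<omega>)) \<in> D"
    and "AE \<omega> in M. \<Gamma> (\<lambda>\<omega>. f (u \<omega>) * h (w \<omega>)) v \<omega> =
      f' (u \<omega>) * h (w \<omega>) * \<Gamma> u v \<omega> + f (u \<omega>) * h' (w \<omega>) * \<Gamma> w v \<omega>"
proof -
  let ?U = "\<lambda>i :: nat. if i = 0 then u else w"
  have U: "\<And>i. ?U i \<in> D" using u w by auto
  note cl = C1_Lipschitz_mult[of f f' B B' h h' C C', OF f h]
  show "(\<lambda>\<omega>. f (u \<omega>) * h (w \<omega>)) \<in> D"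
    using calculus_domain[of 2 ?U, OF U cl] by (simp add: tuple_def)
  have two: "{..<2} = {0, 1 :: nat}" by auto
  show "AE \<omega> in M. \<Gamma> (\<lambda>\<omega>. f (u \<omega>) * h (w \<omega>)) v \<omega> =
      f' (u \<omega>) * h (w \<omega>) * \<Gamma> u v \<omega> + f (u \<omega>) * h' (w \<omega>) * \<Gamma> w v \<omega>"
    using calculus_Gamma[of 2 ?U "\<lambda>y. f (y 0) * h (y 1)" 1 "\<lambda>_. v" "\<lambda>y. y 0", OF U cl _ identity_C1_Lipschitz(1,2)] v
      partial_deriv_mult[of f f' h h', OF f(1) h(1)]
    by (simp add: tuple_def identity_C1_Lipschitz two)
qed

end

section \<open>A bounded continuously differentiable saturation of the identity\<close>

text \<open>On the half-line \<open>t \<ge> 0\<close> the function is \<open>t / (c + t)\<close>,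
  from which both \<open>1 / (c + t)\<close> and the regularisation of
  \<open>1 / \<Gamma> X X\<close> are built. The absolute value removes the pole at
  \<open>- c\<close>, making the calculus applicable on the whole line.\<close>

lemma saturation_deriv:
  fixes c :: real
  assumes "0 < c"
  shows "((\<lambda>t. t / (c + \<bar>t\<bar>)) has_real_derivative c / (c + \<bar>t\<bar>)\<^sup>2) (at t)"
proof (cases "t = 0")
  case True
  \<comment> \<open>At 0 the absolute value has no derivative, but the slope of the whole function
    is \<open>1 / (c + \<bar>z\<bar>)\<close>, which is continuous; this is the criterion of
    Caratheodory.\<close>
  have "isCont (\<lambda>z. 1 / (c + \<bar>z\<bar>)) 0"
    using assms by (intro continuous_intros) auto
  then show ?thesis
    unfolding True CARAT_DERIV using assms
    by (intro exI[of _ "\<lambda>z. 1 / (c + \<bar>z\<bar>)"]) (auto simp: power2_eq_square)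
next
  case False
  have "c + \<bar>t\<bar> \<noteq> 0" using assms by linarith
  moreover have "(abs has_real_derivative sgn t) (at t)"
    using has_derivative_norm[OF False] unfolding has_field_derivative_def
    by (simp add: real_norm_def[abs_def] mult_commute_abs)
  ultimately have "((\<lambda>t. t / (c + \<bar>t\<bar>)) has_real_derivative
      (1 * (c + \<bar>t\<bar>) - t * (0 + sgn t)) / ((c + \<bar>t\<bar>) * (c + \<bar>t\<bar>))) (at t)"
    by (intro DERIV_divide DERIV_add DERIV_const DERIV_ident)
  then show ?thesis
    by (simp add: power2_eq_square mult_sgn_abs abs_sgn[symmetric])
qed

lemma saturation_bounds:
  fixes c :: real
  assumes "0 < c"
  shows "continuous_on UNIV (\<lambda>t. c / (c + \<bar>t\<bar>)\<^sup>2)"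
    and "\<bar>t / (c + \<bar>t\<bar>)\<bar> \<le> 1" and "\<bar>c / (c + \<bar>t\<bar>)\<^sup>2\<bar> \<le> 1 / c"
proof -
  have "c + \<bar>t\<bar> \<noteq> 0" for t using assms by linarith
  then show "continuous_on UNIV (\<lambda>t. c / (c + \<bar>t\<bar>)\<^sup>2)"
    by (intro continuous_intros) auto
  show "\<bar>t / (c + \<bar>t\<bar>)\<bar> \<le> 1"
    using assms by (simp add: abs_div)
  have "c\<^sup>2 \<le> (c + \<bar>t\<bar>)\<^sup>2"
    using assms by (intro power_mono) auto
  then have "c / (c + \<bar>t\<bar>)\<^sup>2 \<le> c / c\<^sup>2"
    using assms by (intro divide_left_mono) auto
  then show "\<bar>c / (c + \<bar>t\<bar>)\<^sup>2\<bar> \<le> 1 / c"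
    using assms by (simp add: power2_eq_square)
qed

section \<open>Integration by parts from the generator\<close>

context error_structure
begin

text \<open>The factor 2 before \<open>A X\<close> comes from the factor 1/2 in the Dirichlet form.
  The product rule splits \<open>\<Gamma> X v\<close> into the term with \<open>R\<close> and the
  term with \<open>\<Gamma> X (1 / (e + \<Gamma> X X))\<close>.\<close>

lemma ibp_pair_generator:
  assumes gen: "generator M D \<Gamma> DA A" and X: "X \<in> DA" and G: "\<Gamma> X X \<in> D"
    and Gpos: "AE \<omega> in M. 0 < \<Gamma> X X \<omega>" and e: "0 < e"
  shows "ibp_pair M X (\<lambda>\<omega>. \<Gamma> X X \<omega> / (e + \<Gamma> X X \<omega>))
    (\<lambda>\<omega>. \<Gamma> X (\<lambda>\<omega>. 1 / (e + \<Gamma> X X \<omega>)) \<omega> + 2 * A X \<omega> / (e + \<Gamma> X X \<omega>))"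
proof -
  let ?G = "\<Gamma> X X"
  let ?q = "\<lambda>\<omega>. 1 / (e + ?G \<omega>)"
  \<comment> \<open>\<open>h\<close> extends \<open>t \<mapsto> 1 / (e + t)\<close> from \<open>t \<ge> 0\<close> to a bounded \<open>C\<^sup>1\<close> Lipschitz function on the line.\<close>
  define h where "h t = (1 - t / (e + \<bar>t\<bar>)) / e" for t
  define h' where "h' t = (0 - e / (e + \<bar>t\<bar>)\<^sup>2) / e" for t
  have h: "\<And>t. (h has_real_derivative h' t) (at t)" "continuous_on UNIV h'"
    "\<And>t. \<bar>h t\<bar> \<le> 2 / e" "\<And>t. \<bar>h' t\<bar> \<le> 1 / e / e"
  proof -
    show "(h has_real_derivative h' t) (at t)" for t
      unfolding h_def[abs_def] h'_def
      by (intro DERIV_cdivide DERIV_diff DERIV_const saturation_deriv e)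
    show "continuous_on UNIV h'"
      unfolding h'_def[abs_def] using e by (intro continuous_intros saturation_bounds) auto
    have "\<bar>1 - t / (e + \<bar>t\<bar>)\<bar> \<le> 2" for t
      using saturation_bounds(2)[OF e, of t] by linarith
    then show "\<bar>h t\<bar> \<le> 2 / e" for t
      using e unfolding h_def by (simp add: abs_div divide_right_mono)
    show "\<bar>h' t\<bar> \<le> 1 / e / e" for t
      using e saturation_bounds(3)[OF e, of t] divide_right_mono[OF saturation_bounds(3)[OF e, of t], of e]
      unfolding h'_def by (simp add: abs_div)
  qed
  have XD: "X \<in> D" and AX: "A X \<in> L2 M"
    and green: "\<And>v. v \<in> D \<Longrightarrow> dirichlet_form M \<Gamma> X v = - L2_inner M (A X) v"
    using gen X unfolding generator_def L2_self_adjoint_def by auto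
  have [measurable]: "X \<in> borel_measurable M" "?G \<in> borel_measurable M" "A X \<in> borel_measurable M"
    using XD G AX by (auto simp: L2_def intro: domain_measurable)
  have "continuous_on UNIV h"
    by (rule DERIV_continuous_on[OF has_field_derivative_at_within[OF h(1)]])
  then have [measurable]: "h \<in> borel_measurable borel"
    by (rule borel_measurable_continuous_onI)
  have iAX: "integrable M (A X)"
    using AX by (auto simp: L2_def intro: square_integrable_imp_integrable)
  have hq: "AE \<omega> in M. h (?G \<omega>) = ?q \<omega>"
    using Gpos
  proof eventually_elim
    case (elim \<omega>)
    then have "1 - ?G \<omega> / (e + ?G \<omega>) = e / (e + ?G \<omega>)"
      using e by (simp add: field_simps)
    then show ?case
      using elim e by (simp add: h_def)
  qed
  have hD: "(\<lambda>\<omega>. h (?G \<omega>)) \<in> D"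
    using Gamma_chain(1)[OF G XD h(1,2,4)] .
  \<comment> \<open>The calculus yields membership for \<open>h (\<Gamma> X X)\<close>; positivity
    of \<open>\<Gamma> X X\<close> holds only almost surely, so saturation of \<open>D\<close>
    carries the membership over.\<close>
  have qD: "?q \<in> D"
    by (rule domain_cong[OF hD _ hq]) measurable
  have iq: "integrable M (\<Gamma> X ?q)"
    by (rule Gamma_integrable[OF XD qD])
  note [measurable] = borel_measurable_integrable[OF iq]
  have Gq: "AE \<omega> in M. \<Gamma> X ?q \<omega> = h' (?G \<omega>) * \<Gamma> ?G X \<omega>"
    using Gamma_sym[OF XD qD] Gamma_cong[OF hD qD XD hq] Gamma_chain(2)[OF G XD h(1,2,4)]
    by eventually_elim simp
  show ?thesis
    unfolding ibp_pair_def
  proof (intro conjI allI impI)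
    show iR: "integrable M (\<lambda>\<omega>. ?G \<omega> / (e + ?G \<omega>))"
    proof (rule Bochner_Integration.integrable_bound[where f = "\<lambda>_. 1 :: real"])
      show "AE \<omega> in M. norm (?G \<omega> / (e + ?G \<omega>)) \<le> norm (1 :: real)"
        using Gpos by eventually_elim (use e in \<open>simp add: field_simps\<close>)
    qed auto
    \<comment> \<open>\<open>A X\<close> is integrable, being square integrable on a probability
      space, and \<open>h\<close> is bounded by \<open>2 / e\<close>.\<close>
    have iAh: "integrable M (\<lambda>\<omega>. h (?G \<omega>) * A X \<omega>)"
      by (rule integrable_bounded_mult[OF iAX _ h(3)]) measurable
    have "integrable M (\<lambda>\<omega>. \<Gamma> X ?q \<omega> + 2 * (h (?G \<omega>) * A X \<omega>))"
      using iq iAh by auto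
    moreover have Weq: "AE \<omega> in M. \<Gamma> X ?q \<omega> + 2 * (h (?G \<omega>) * A X \<omega>) =
        \<Gamma> X ?q \<omega> + 2 * A X \<omega> / (e + ?G \<omega>)"
      using hq by eventually_elim simp
    ultimately show "integrable M (\<lambda>\<omega>. \<Gamma> X ?q \<omega> + 2 * A X \<omega> / (e + ?G \<omega>))"
      using borel_measurable_integrable[OF iq] by (subst integrable_cong_AE[OF _ _ Weq, symmetric]) auto
    fix \<phi> \<phi>' :: "real \<Rightarrow> real"
    assume "\<forall>x. (\<phi> has_real_derivative \<phi>' x) (at x)" and c: "continuous_on UNIV \<phi>'"
      and b: "bounded (range \<phi>)" "bounded (range \<phi>')"
    then have d: "\<And>x. (\<phi> has_real_derivative \<phi>' x) (at x)" by auto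
    obtain B B' where B: "\<And>x. \<bar>\<phi> x\<bar> \<le> B" "\<And>x. \<bar>\<phi>' x\<bar> \<le> B'"
      using b unfolding bounded_iff by auto
    have "continuous_on UNIV \<phi>"
      by (rule DERIV_continuous_on[OF has_field_derivative_at_within[OF d]])
    then have [measurable]: "\<phi> \<in> borel_measurable borel" "\<phi>' \<in> borel_measurable borel"
      using c by (auto intro: borel_measurable_continuous_onI)
    let ?v = "\<lambda>\<omega>. \<phi> (X \<omega>) * h (?G \<omega>)"
    note prod = Gamma_product[OF XD G XD d c B h]
    have i1: "integrable M (\<lambda>\<omega>. \<phi>' (X \<omega>) * (?G \<omega> / (e + ?G \<omega>)))"
      by (rule integrable_bounded_mult[OF iR _ B(2)]) measurable
    have i2: "integrable M (\<lambda>\<omega>. \<phi> (X \<omega>) * \<Gamma> X ?q \<omega>)"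
      by (rule integrable_bounded_mult[OF iq _ B(1)]) measurable
    have i3: "integrable M (\<lambda>\<omega>. \<phi> (X \<omega>) * (h (?G \<omega>) * A X \<omega>))"
      by (rule integrable_bounded_mult[OF iAh _ B(1)]) measurable
    \<comment> \<open>In the product rule \<open>h (\<Gamma> X X) * \<Gamma> X X\<close> becomes the
      weight \<open>R\<close>, and by \<open>Gq\<close> the term with the derivative of
      \<open>h\<close> becomes the term with \<open>\<Gamma> X ?q\<close>.\<close>
    have "AE \<omega> in M. \<Gamma> X ?v \<omega> = \<phi>' (X \<omega>) * (?G \<omega> / (e + ?G \<omega>)) + \<phi> (X \<omega>) * \<Gamma> X ?q \<omega>"
      using Gamma_sym[OF XD prod(1)] prod(2) Gq hq by eventually_elim simp
    then have "(\<integral>\<omega>. \<Gamma> X ?v \<omega> \<partial>M) =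
        (\<integral>\<omega>. \<phi>' (X \<omega>) * (?G \<omega> / (e + ?G \<omega>)) + \<phi> (X \<omega>) * \<Gamma> X ?q \<omega> \<partial>M)"
      using borel_measurable_integrable[OF Gamma_integrable[OF XD prod(1)]]
        borel_measurable_integrable[OF i1] borel_measurable_integrable[OF i2]
      by (intro integral_cong_AE) auto
    then have "(\<integral>\<omega>. \<Gamma> X ?v \<omega> \<partial>M) =
        (\<integral>\<omega>. \<phi>' (X \<omega>) * (?G \<omega> / (e + ?G \<omega>)) \<partial>M) + (\<integral>\<omega>. \<phi> (X \<omega>) * \<Gamma> X ?q \<omega> \<partial>M)"
      using i1 i2 by simp
    moreover have "(\<integral>\<omega>. \<Gamma> X ?v \<omega> \<partial>M) = - 2 * (\<integral>\<omega>. \<phi> (X \<omega>) * (h (?G \<omega>) * A X \<omega>) \<partial>M)"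
      using green[OF prod(1)] by (simp add: dirichlet_form_def L2_inner_def mult_ac)
    moreover have "(\<integral>\<omega>. \<phi> (X \<omega>) * (\<Gamma> X ?q \<omega> + 2 * A X \<omega> / (e + ?G \<omega>)) \<partial>M) =
        (\<integral>\<omega>. \<phi> (X \<omega>) * \<Gamma> X ?q \<omega> + 2 * (\<phi> (X \<omega>) * (h (?G \<omega>) * A X \<omega>)) \<partial>M)"
    proof (intro integral_cong_AE)
      show "AE \<omega> in M. \<phi> (X \<omega>) * (\<Gamma> X ?q \<omega> + 2 * A X \<omega> / (e + ?G \<omega>)) =
          \<phi> (X \<omega>) * \<Gamma> X ?q \<omega> + 2 * (\<phi> (X \<omega>) * (h (?G \<omega>) * A X \<omega>))"
        using hq by eventually_elim (simp add: algebra_simps)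
    qed measurable
    then have "(\<integral>\<omega>. \<phi> (X \<omega>) * (\<Gamma> X ?q \<omega> + 2 * A X \<omega> / (e + ?G \<omega>)) \<partial>M) =
        (\<integral>\<omega>. \<phi> (X \<omega>) * \<Gamma> X ?q \<omega> \<partial>M) + 2 * (\<integral>\<omega>. \<phi> (X \<omega>) * (h (?G \<omega>) * A X \<omega>) \<partial>M)"
      using i2 i3 by simp
    ultimately show "(\<integral>\<omega>. \<phi>' (X \<omega>) * (?G \<omega> / (e + ?G \<omega>)) \<partial>M) =
        - (\<integral>\<omega>. \<phi> (X \<omega>) * (\<Gamma> X ?q \<omega> + 2 * A X \<omega> / (e + ?G \<omega>)) \<partial>M)"
      by linarith
  qed
qed

text \<open>The regularised formulas at \<open>1 / Suc n\<close> are passed to the limit. With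
  \<open>K = 1 / \<Gamma> X X\<close>, the part with \<Gamma> is dominated by
  \<open>\<Gamma> K X\<close>, and the part with \<open>A X\<close> is handled by square
  integrability of \<open>K\<close>, a member of \<open>D\<close>.\<close>

lemma ibp_pair_generator_inverse:
  assumes gen: "generator M D \<Gamma> DA A" and X: "X \<in> DA" and G: "\<Gamma> X X \<in> D"
    and Gpos: "AE \<omega> in M. 0 < \<Gamma> X X \<omega>" and K: "(\<lambda>\<omega>. 1 / \<Gamma> X X \<omega>) \<in> D"
  shows "ibp_pair M X (\<lambda>_. 1) (\<lambda>\<omega>. \<Gamma> X (\<lambda>\<omega>. 1 / \<Gamma> X X \<omega>) \<omega> + 2 * A X \<omega> / \<Gamma> X X \<omega>)"
proof -
  let ?G = "\<Gamma> X X"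
  let ?K = "\<lambda>\<omega>. 1 / ?G \<omega>"
  let ?q = "\<lambda>n \<omega>. 1 / (1 / real (Suc n) + ?G \<omega>)"
  have XD: "X \<in> D" and AX: "A X \<in> L2 M"
    using gen X unfolding generator_def L2_self_adjoint_def by auto
  have [measurable]: "X \<in> borel_measurable M" "?G \<in> borel_measurable M" "A X \<in> borel_measurable M"
    "\<Gamma> X ?K \<in> borel_measurable M"
    using XD G AX Gamma_integrable[OF XD K] by (auto simp: L2_def intro: domain_measurable)
  have qlim: "(\<lambda>n. 1 / (1 / real (Suc n) + y)) \<longlonglongrightarrow> 1 / y" if "y > 0" for y :: real
    using tendsto_divide[OF tendsto_const tendsto_add[OF LIMSEQ_Suc[OF lim_1_over_n] tendsto_const], of y 1] that
    by simp
  have ratio_lim: "(\<lambda>n. real (Suc n) / (real (Suc n) + k)) \<longlonglongrightarrow> 1" if "k \<ge> 0" for k :: real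
  proof -
    have "(\<lambda>n. 1 / (1 + k * (1 / real (Suc n)))) \<longlonglongrightarrow> 1 / (1 + k * 0)"
      by (intro tendsto_divide tendsto_add tendsto_mult tendsto_const LIMSEQ_Suc[OF lim_1_over_n]) auto
    moreover have "1 / (1 + k * (1 / real (Suc n))) = real (Suc n) / (real (Suc n) + k)" for n
    proof -
      have "1 + k * (1 / real (Suc n)) = (real (Suc n) + k) / real (Suc n)"
        by (simp add: add_divide_distrib del: of_nat_Suc)
      then show ?thesis by (simp only: divide_divide_eq_right mult_1)
    qed
    ultimately show ?thesis by simp
  qed
  have Gq: "AE \<omega> in M. \<Gamma> X (?q n) \<omega> = (real (Suc n) / (real (Suc n) + \<bar>?K \<omega>\<bar>))\<^sup>2 * \<Gamma> ?K X \<omega>" for n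
  proof -
    define c where "c = real (Suc n)"
    have c: "c > 0" by (simp add: c_def)
    \<comment> \<open>Writing \<open>?q n\<close> as a function of \<open>1 / \<Gamma> X X\<close> makes \<open>\<Gamma> X (?q n)\<close> dominated uniformly in \<open>n\<close>.\<close>
    define k where "k t = c * (t / (c + \<bar>t\<bar>))" for t
    define k' where "k' t = c * (c / (c + \<bar>t\<bar>)\<^sup>2)" for t
    have k: "\<And>t. (k has_real_derivative k' t) (at t)" "continuous_on UNIV k'" "\<And>t. \<bar>k' t\<bar> \<le> c * (1 / c)"
    proof -
      show "(k has_real_derivative k' t) (at t)" for t
        unfolding k_def[abs_def] k'_def by (intro DERIV_cmult saturation_deriv c)
      show "continuous_on UNIV k'"
        unfolding k'_def[abs_def] by (intro continuous_on_mult continuous_on_const saturation_bounds c)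
      show "\<bar>k' t\<bar> \<le> c * (1 / c)" for t
        unfolding k'_def abs_mult[of c] abs_of_pos[OF c]
        using c by (intro mult_left_mono saturation_bounds(3)) auto
    qed
    have kq: "AE \<omega> in M. k (?K \<omega>) = ?q n \<omega>"
      using Gpos unfolding c_def[symmetric]
      by eventually_elim (use c in \<open>simp add: k_def field_simps\<close>)
    have kD: "(\<lambda>\<omega>. k (?K \<omega>)) \<in> D"
      by (rule Gamma_chain(1)[OF K XD k])
    have qD: "?q n \<in> D"
      by (rule domain_cong[OF kD _ kq]) measurable
    show ?thesis
      using Gamma_sym[OF XD qD] Gamma_cong[OF kD qD XD kq] Gamma_chain(2)[OF K XD k]
      unfolding c_def[symmetric] by eventually_elim (simp add: k'_def power2_eq_square)
  qed
  show ?thesis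
  proof (rule ibp_pair_limit)
    show "ibp_pair M X (\<lambda>\<omega>. ?G \<omega> / (1 / real (Suc n) + ?G \<omega>))
        (\<lambda>\<omega>. \<Gamma> X (?q n) \<omega> + 2 * A X \<omega> / (1 / real (Suc n) + ?G \<omega>))" for n
      by (rule ibp_pair_generator[OF gen X G Gpos]) simp
    show "AE \<omega> in M. (\<lambda>n. ?G \<omega> / (1 / real (Suc n) + ?G \<omega>)) \<longlonglongrightarrow> 1"
      using Gpos
    proof eventually_elim
      case (elim \<omega>)
      then show ?case
        using tendsto_mult_left[OF qlim[OF elim], of "?G \<omega>"] by simp
    qed
    show "AE \<omega> in M. \<bar>?G \<omega> / (1 / real (Suc n) + ?G \<omega>)\<bar> \<le> 1" for n
      using Gpos
    proof eventually_elim
      case (elim \<omega>)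
      then have "?G \<omega> \<le> 1 / real (Suc n) + ?G \<omega>" "0 < 1 / real (Suc n) + ?G \<omega>"
        by (auto intro: add_pos_pos)
      then show ?case using elim by (simp add: abs_div)
    qed
    \<comment> \<open>The exceptional null sets for all \<open>n\<close> are merged, so that the
      limit can be taken at a fixed outcome.\<close>
    have "AE \<omega> in M. \<forall>n. \<Gamma> X (?q n) \<omega> = (real (Suc n) / (real (Suc n) + \<bar>?K \<omega>\<bar>))\<^sup>2 * \<Gamma> ?K X \<omega>"
      using Gq by (simp add: AE_all_countable)
    then show "AE \<omega> in M. (\<lambda>n. \<Gamma> X (?q n) \<omega> + 2 * A X \<omega> / (1 / real (Suc n) + ?G \<omega>))
        \<longlonglongrightarrow> \<Gamma> X ?K \<omega> + 2 * A X \<omega> / ?G \<omega>"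
      using Gamma_sym[OF XD K] Gpos
    proof eventually_elim
      case (elim \<omega>)
      have "(\<lambda>n. real (Suc n) / (real (Suc n) + \<bar>?K \<omega>\<bar>)) \<longlonglongrightarrow> 1"
        by (rule ratio_lim) simp
      then have "(\<lambda>n. (real (Suc n) / (real (Suc n) + \<bar>?K \<omega>\<bar>))\<^sup>2 * \<Gamma> ?K X \<omega>) \<longlonglongrightarrow> 1\<^sup>2 * \<Gamma> ?K X \<omega>"
        by (intro tendsto_intros)
      then have "(\<lambda>n. \<Gamma> X (?q n) \<omega>) \<longlonglongrightarrow> \<Gamma> X ?K \<omega>"
        using elim by simp
      then show ?case
        using tendsto_add[OF _ tendsto_mult_left[OF qlim[OF elim(3)], of "2 * A X \<omega>"]] by simp
    qed
    \<comment> \<open>The squared ratio is at most 1, which bounds the first term. For the second,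
      \<open>1 / (1 / Suc n + \<Gamma> X X)\<close> is at most \<open>K\<close>, and twice a product
      is at most the sum of the squares.\<close>
    show "AE \<omega> in M. \<bar>\<Gamma> X (?q n) \<omega> + 2 * A X \<omega> / (1 / real (Suc n) + ?G \<omega>)\<bar>
        \<le> \<bar>\<Gamma> ?K X \<omega>\<bar> + ((A X \<omega>)\<^sup>2 + (?K \<omega>)\<^sup>2)" for n
      using Gq[of n] Gpos
    proof eventually_elim
      case (elim \<omega>)
      have "real (Suc n) / (real (Suc n) + \<bar>?K \<omega>\<bar>) \<le> 1"
        by (subst divide_le_eq_1_pos) (auto intro!: add_pos_nonneg)
      then have "(real (Suc n) / (real (Suc n) + \<bar>?K \<omega>\<bar>))\<^sup>2 \<le> 1"
        by (intro power_le_one) auto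
      then have "\<bar>\<Gamma> X (?q n) \<omega>\<bar> \<le> \<bar>\<Gamma> ?K X \<omega>\<bar>"
        unfolding elim(1) abs_mult by (intro mult_left_le_one_le) auto
      moreover have "\<bar>2 * A X \<omega> / (1 / real (Suc n) + ?G \<omega>)\<bar> \<le> (A X \<omega>)\<^sup>2 + (?K \<omega>)\<^sup>2"
      proof -
        have "1 / (1 / real (Suc n) + ?G \<omega>) \<le> ?K \<omega>"
          using elim(2) by (intro divide_left_mono mult_pos_pos add_pos_pos) auto
        moreover have "0 < 1 / real (Suc n) + ?G \<omega>"
          using elim(2) by (intro add_pos_pos) auto
        ultimately have "\<bar>2 * A X \<omega> / (1 / real (Suc n) + ?G \<omega>)\<bar> \<le> 2 * \<bar>A X \<omega>\<bar> * ?K \<omega>"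
          using mult_left_mono[of "1 / (1 / real (Suc n) + ?G \<omega>)" "?K \<omega>" "2 * \<bar>A X \<omega>\<bar>"]
          by (simp add: abs_mult abs_div)
        also have "\<dots> \<le> (A X \<omega>)\<^sup>2 + (?K \<omega>)\<^sup>2"
          using sum_squares_bound[of "\<bar>A X \<omega>\<bar>" "?K \<omega>"] by simp
        finally show ?thesis .
      qed
      ultimately show ?case by linarith
    qed
    show "integrable M (\<lambda>\<omega>. \<bar>\<Gamma> ?K X \<omega>\<bar> + ((A X \<omega>)\<^sup>2 + (?K \<omega>)\<^sup>2))"
      using Gamma_integrable[OF K XD] AX domain_square_integrable[OF K]
      by (auto simp: L2_def intro!: Bochner_Integration.integrable_add)
    show "integrable M (\<lambda>_. 1 :: real)" by simp
  qed measurable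
qed

end

section \<open>Regularity of the density\<close>

lemma sign_mean_diff:
  assumes "integrable M W" "integrable M W'" and [measurable]: "X \<in> borel_measurable M"
  shows "sign_mean M X (\<lambda>\<omega>. W \<omega> - W' \<omega>) x = sign_mean M X W x - sign_mean M X W' x"
proof -
  have "integrable M (\<lambda>\<omega>. sgn (x - X \<omega>) * W \<omega>)" "integrable M (\<lambda>\<omega>. sgn (x - X \<omega>) * W' \<omega>)"
    using assms by (auto intro!: integrable_bounded_mult[where B = 1] simp: sgn_if)
  then show ?thesis
    by (simp add: sign_mean_def right_diff_distrib)
qed

text \<open>Half the difference of the two signs is the indicator of the open interval, except when
  \<open>X\<close> equals an endpoint, which has probability 0.\<close>

lemma ibp_pair_increment:
  assumes ibp: "ibp_pair M X R W" and [measurable]: "X \<in> borel_measurable M"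
    and no_atoms: "\<And>c. AE \<omega> in M. X \<omega> \<noteq> c" and "a \<le> b"
  shows "\<bar>sign_mean M X W b - sign_mean M X W a\<bar> \<le> (\<integral>\<omega>. indicator {a<..<b} (X \<omega>) * \<bar>W \<omega>\<bar> \<partial>M)"
proof -
  have W: "integrable M W" using ibp by (simp add: ibp_pair_def)
  note [measurable] = borel_measurable_integrable[OF W]
  have "integrable M (\<lambda>\<omega>. sgn (c - X \<omega>) * W \<omega>)" for c
    using W by (auto intro!: integrable_bounded_mult[where B = 1] simp: sgn_if)
  then have "sign_mean M X W b - sign_mean M X W a =
      (\<integral>\<omega>. 1 / 2 * (sgn (b - X \<omega>) * W \<omega> - sgn (a - X \<omega>) * W \<omega>) \<partial>M)"
    by (simp add: sign_mean_def)
  also have "\<dots> = (\<integral>\<omega>. indicator {a<..<b} (X \<omega>) * W \<omega> \<partial>M)"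
  proof (rule integral_cong_AE)
    show "AE \<omega> in M. 1 / 2 * (sgn (b - X \<omega>) * W \<omega> - sgn (a - X \<omega>) * W \<omega>) =
        indicator {a<..<b} (X \<omega>) * W \<omega>"
      using no_atoms[of a] no_atoms[of b]
    proof eventually_elim
      case (elim \<omega>)
      then consider "X \<omega> < a" | "a < X \<omega>" "X \<omega> < b" | "b < X \<omega>" by linarith
      then show ?case using \<open>a \<le> b\<close> by cases auto
    qed
  qed measurable
  also have "\<bar>\<dots>\<bar> \<le> (\<integral>\<omega>. indicator {a<..<b} (X \<omega>) * \<bar>W \<omega>\<bar> \<partial>M)"
    using integral_abs_bound[of M "\<lambda>\<omega>. indicator {a<..<b} (X \<omega>) * W \<omega>"] by (simp add: abs_mult)
  finally show ?thesis .
qed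

text \<open>The indicator is at most the difference of signs in \<open>ibp_pair_abs\<close>, and the
  difference of absolute values on the other side is at most \<open>b - a\<close> in
  modulus.\<close>

lemma ibp_pair_interval_bound:
  assumes ibp: "ibp_pair M X (\<lambda>_. 1) W" and [measurable]: "X \<in> borel_measurable M" and "a \<le> b"
  shows "(\<integral>\<omega>. indicator {a<..<b} (X \<omega>) \<partial>M) \<le> (b - a) * (\<integral>\<omega>. \<bar>W \<omega>\<bar> \<partial>M)"
proof -
  have int: "integrable M (\<lambda>_. 1 :: real)" "integrable M W" using ibp by (auto simp: ibp_pair_def)
  have "(\<integral>\<omega>. indicator {a<..<b} (X \<omega>) * 1 \<partial>M) \<le> (\<integral>\<omega>. (sgn (X \<omega> - a) - sgn (X \<omega> - b)) * 1 \<partial>M)"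
  proof (rule integral_mono)
    show "integrable M (\<lambda>\<omega>. indicator {a<..<b} (X \<omega>) * (1 :: real))"
      by (rule integrable_bounded_mult[OF int(1), where B = 1]) auto
    show "integrable M (\<lambda>\<omega>. (sgn (X \<omega> - a) - sgn (X \<omega> - b)) * (1 :: real))"
      by (rule integrable_bounded_mult[OF int(1), where B = 2]) (auto simp: sgn_if)
  qed (use \<open>a \<le> b\<close> in \<open>auto simp: indicator_def sgn_if\<close>)
  also have "\<dots> = (\<integral>\<omega>. (\<bar>X \<omega> - b\<bar> - \<bar>X \<omega> - a\<bar>) * W \<omega> \<partial>M)"
    by (rule ibp_pair_abs[OF ibp]) measurable
  also have "\<dots> \<le> (\<integral>\<omega>. (b - a) * \<bar>W \<omega>\<bar> \<partial>M)"
  proof (rule integral_mono)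
    show "integrable M (\<lambda>\<omega>. (\<bar>X \<omega> - b\<bar> - \<bar>X \<omega> - a\<bar>) * W \<omega>)"
      by (rule integrable_bounded_mult[OF int(2), where B = "b - a"]) (use \<open>a \<le> b\<close> in auto)
    show "(\<bar>X \<omega> - b\<bar> - \<bar>X \<omega> - a\<bar>) * W \<omega> \<le> (b - a) * \<bar>W \<omega>\<bar>" for \<omega>
    proof -
      have "\<bar>\<bar>X \<omega> - b\<bar> - \<bar>X \<omega> - a\<bar>\<bar> * \<bar>W \<omega>\<bar> \<le> (b - a) * \<bar>W \<omega>\<bar>"
        using \<open>a \<le> b\<close> by (intro mult_right_mono) auto
      then show ?thesis
        by (simp add: abs_mult[symmetric] abs_le_iff)
    qed
  qed (use int in auto)
  finally show ?thesis by simp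
qed

lemma mult_half_cancel: "k * (e / (2 * k)) = e / 2" if "k > 0" for k e :: real
  using that by (simp add: field_simps)

text \<open>The modulus of \<open>W\<close> is cut at a level \<open>N\<close>. The part above
  \<open>N\<close> has small integral whatever the intervals are; the part below contributes at most
  \<open>N\<close> times the probability that \<open>X\<close> falls in them, which
  \<open>ibp_pair_interval_bound\<close> controls by their total length.\<close>

lemma ibp_pair_abs_continuous:
  assumes ibp: "ibp_pair M X (\<lambda>_. 1) W" and [measurable]: "X \<in> borel_measurable M"
  shows "abs_continuous_on UNIV (sign_mean M X W)"
  unfolding abs_continuous_on_def
proof (intro allI impI)
  fix e :: real assume e: "e > 0"
  have no_atoms: "\<And>c. AE \<omega> in M. X \<omega> \<noteq> c"
    by (rule ibp_pair_no_atoms[OF ibp]) auto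
  have int: "integrable M (\<lambda>_. 1 :: real)" "integrable M (\<lambda>\<omega>. \<bar>W \<omega>\<bar>)"
    using ibp by (auto simp: ibp_pair_def)
  have [measurable]: "W \<in> borel_measurable M"
    using ibp by (auto simp: ibp_pair_def)
  define V where "V N \<omega> = indicator {real N<..} \<bar>W \<omega>\<bar> * \<bar>W \<omega>\<bar>" for N \<omega>
  have V: "integrable M (V N)" for N
    unfolding V_def[abs_def] by (rule integrable_bounded_mult[OF int(2), where B = 1]) auto
  have "(\<lambda>N. \<integral>\<omega>. V N \<omega> \<partial>M) \<longlonglongrightarrow> (\<integral>\<omega>. 0 * \<bar>W \<omega>\<bar> \<partial>M)"
    unfolding V_def
  proof (rule tendsto_integral_bounded_mult[OF int(2), where B = 1])
    show "AE \<omega> in M. (\<lambda>N. indicator {real N<..} \<bar>W \<omega>\<bar> :: real) \<longlonglongrightarrow> 0"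
    proof (rule AE_I2)
      fix \<omega>
      have "eventually (\<lambda>N. \<bar>W \<omega>\<bar> \<le> real N) sequentially"
        using filterlim_real_sequentially by (auto simp: filterlim_at_top)
      then have "eventually (\<lambda>N. (indicator {real N<..} \<bar>W \<omega>\<bar> :: real) = 0) sequentially"
        by eventually_elim auto
      then show "(\<lambda>N. indicator {real N<..} \<bar>W \<omega>\<bar> :: real) \<longlonglongrightarrow> 0" by (rule tendsto_eventually)
    qed
  qed auto
  then have "(\<lambda>N. \<integral>\<omega>. V N \<omega> \<partial>M) \<longlonglongrightarrow> 0"
    by simp
  then have "eventually (\<lambda>N. (\<integral>\<omega>. V N \<omega> \<partial>M) < e / 2) sequentially"
    by (rule order_tendstoD(2)) (use e in simp)
  then obtain N where N: "(\<integral>\<omega>. V N \<omega> \<partial>M) < e / 2"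
    by (auto simp: eventually_sequentially)
  define C where "C = (\<integral>\<omega>. \<bar>W \<omega>\<bar> \<partial>M)"
  have C: "C \<ge> 0" by (simp add: C_def)
  \<comment> \<open>Chosen so that \<open>N * C * d\<close> is at most \<open>e / 2\<close>; the
    added 1 keeps the denominator positive when \<open>N * C\<close> is 0.\<close>
  define d where "d = e / (2 * (real N * C + 1))"
  have pos: "real N * C + 1 > 0" using C by (simp add: add_nonneg_pos)
  have d: "d > 0" using e pos by (simp add: d_def)
  have *: "(\<Sum>i<n. \<bar>sign_mean M X W (b i) - sign_mean M X W (a i)\<bar>) < e"
    if ab: "\<forall>i<n. a i \<le> b i \<and> {a i..b i} \<subseteq> UNIV"
      and disj: "\<forall>i<n. \<forall>j<n. i \<noteq> j \<longrightarrow> {a i<..<b i} \<inter> {a j<..<b j} = {}"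
      and small: "(\<Sum>i<n. b i - a i) < d"
    for n :: nat and a b :: "nat \<Rightarrow> real"
  proof -
    let ?I = "\<lambda>i \<omega>. indicator {a i<..<b i} (X \<omega>) :: real"
    have i1: "integrable M (?I i)" for i
      using integrable_bounded_mult[OF int(1), of "?I i" 1] by simp
    have i2: "integrable M (\<lambda>\<omega>. ?I i \<omega> * V N \<omega>)" for i
      by (rule integrable_bounded_mult[OF V, where B = 1]) auto
    have "(\<Sum>i<n. \<bar>sign_mean M X W (b i) - sign_mean M X W (a i)\<bar>) \<le>
        (\<Sum>i<n. real N * C * (b i - a i) + (\<integral>\<omega>. ?I i \<omega> * V N \<omega> \<partial>M))"
    proof (rule sum_mono)
      fix i assume "i \<in> {..<n}"
      then have le: "a i \<le> b i" using ab by auto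
      have "\<bar>sign_mean M X W (b i) - sign_mean M X W (a i)\<bar> \<le> (\<integral>\<omega>. ?I i \<omega> * \<bar>W \<omega>\<bar> \<partial>M)"
        by (rule ibp_pair_increment[OF ibp _ no_atoms le]) measurable
      also have "\<dots> \<le> (\<integral>\<omega>. real N * ?I i \<omega> + ?I i \<omega> * V N \<omega> \<partial>M)"
      proof (rule integral_mono)
        show "integrable M (\<lambda>\<omega>. ?I i \<omega> * \<bar>W \<omega>\<bar>)"
          by (rule integrable_bounded_mult[OF int(2), where B = 1]) auto
        show "integrable M (\<lambda>\<omega>. real N * ?I i \<omega> + ?I i \<omega> * V N \<omega>)"
          using i1 i2 by auto
      qed (auto simp: V_def indicator_def)
      also have "\<dots> = real N * (\<integral>\<omega>. ?I i \<omega> \<partial>M) + (\<integral>\<omega>. ?I i \<omega> * V N \<omega> \<partial>M)"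
        using i1 i2 by simp
      also have "\<dots> \<le> real N * ((b i - a i) * C) + (\<integral>\<omega>. ?I i \<omega> * V N \<omega> \<partial>M)"
        unfolding C_def
        by (intro add_right_mono mult_left_mono ibp_pair_interval_bound[OF ibp _ le]) auto
      finally show "\<bar>sign_mean M X W (b i) - sign_mean M X W (a i)\<bar> \<le>
          real N * C * (b i - a i) + (\<integral>\<omega>. ?I i \<omega> * V N \<omega> \<partial>M)"
        by (simp add: mult_ac)
    qed
    also have "\<dots> = real N * C * (\<Sum>i<n. b i - a i) + (\<Sum>i<n. \<integral>\<omega>. ?I i \<omega> * V N \<omega> \<partial>M)"
      by (simp add: sum.distrib sum_distrib_left)
    also have "(\<Sum>i<n. \<integral>\<omega>. ?I i \<omega> * V N \<omega> \<partial>M) = (\<integral>\<omega>. (\<Sum>i<n. ?I i \<omega> * V N \<omega>) \<partial>M)"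
      by (rule Bochner_Integration.integral_sum[symmetric]) (rule i2)
    also have "\<dots> \<le> (\<integral>\<omega>. V N \<omega> \<partial>M)"
    proof (rule integral_mono)
      \<comment> \<open>Disjointness turns the sum of indicators into the indicator of a union, so
        the tail \<open>V N\<close> is counted at most once.\<close>
      have disj': "disjoint_family_on (\<lambda>i. {a i<..<b i}) {..<n}"
        using disj by (auto simp: disjoint_family_on_def)
      show "(\<Sum>i<n. ?I i \<omega> * V N \<omega>) \<le> V N \<omega>" for \<omega>
        unfolding sum_distrib_right[symmetric] indicator_UN_disjoint[OF finite_lessThan disj', symmetric]
        by (intro mult_left_le_one_le) (auto simp: V_def)
      show "integrable M (\<lambda>\<omega>. \<Sum>i<n. ?I i \<omega> * V N \<omega>)"
        by (intro Bochner_Integration.integrable_sum i2)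
    qed (rule V)
    also have "real N * C * (\<Sum>i<n. b i - a i) + (\<integral>\<omega>. V N \<omega> \<partial>M) < e / 2 + e / 2"
    proof (rule add_le_less_mono[OF _ N])
      have "real N * C * (\<Sum>i<n. b i - a i) \<le> real N * C * d"
        using small C by (intro mult_left_mono) auto
      also have "\<dots> \<le> (real N * C + 1) * d"
        using d by (simp add: distrib_right)
      also have "\<dots> = e / 2"
        unfolding d_def using pos by (intro mult_half_cancel)
      finally show "real N * C * (\<Sum>i<n. b i - a i) \<le> e / 2" .
    qed
    finally show ?thesis by simp
  qed
  show "\<exists>d>0. \<forall>(n::nat) a b.
        (\<forall>i<n. a i \<le> b i \<and> {a i..b i} \<subseteq> UNIV) \<and>
        (\<forall>i<n. \<forall>j<n. i \<noteq> j \<longrightarrow> {a i<..<b i} \<inter> {a j<..<b j} = {}) \<and>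
        (\<Sum>i<n. b i - a i) < d
        \<longrightarrow> (\<Sum>i<n. \<bar>sign_mean M X W (b i) - sign_mean M X W (a i)\<bar>) < e"
  proof (rule exI[of _ d], rule conjI[OF d], rule allI, rule allI, rule allI, rule impI)
    fix n :: nat and a b :: "nat \<Rightarrow> real"
    assume "(\<forall>i<n. a i \<le> b i \<and> {a i..b i} \<subseteq> UNIV) \<and>
        (\<forall>i<n. \<forall>j<n. i \<noteq> j \<longrightarrow> {a i<..<b i} \<inter> {a j<..<b j} = {}) \<and>
        (\<Sum>i<n. b i - a i) < d"
    then show "(\<Sum>i<n. \<bar>sign_mean M X W (b i) - sign_mean M X W (a i)\<bar>) < e"
      using *[of n a b] by simp
  qed
qed

section \<open>Monotone limits of weighted densities\<close>

text \<open>Since \<open>R\<close> increases to 1, monotone convergence on the probability space and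
  on the line identifies the supremum of the densities as a density of \<open>X\<close>. No limit of
  \<open>W\<close> is required. The supremum may be infinite at some points, hence the values in
  \<open>ennreal\<close>.\<close>

lemma ibp_family_density:
  fixes R W :: "real \<Rightarrow> 'a \<Rightarrow> real"
  assumes ibp: "\<And>\<epsilon>. 0 < \<epsilon> \<Longrightarrow> ibp_pair M X (R \<epsilon>) (W \<epsilon>)" and X[measurable]: "X \<in> borel_measurable M"
    and Rpos: "\<And>\<epsilon>. 0 < \<epsilon> \<Longrightarrow> AE \<omega> in M. 0 < R \<epsilon> \<omega>"
    and Rmono: "\<And>\<epsilon> \<delta>. 0 < \<epsilon> \<Longrightarrow> \<epsilon> \<le> \<delta> \<Longrightarrow> AE \<omega> in M. R \<delta> \<omega> \<le> R \<epsilon> \<omega>"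
    and Rlim: "AE \<omega> in M. (\<lambda>n. R (1 / real (Suc n)) \<omega>) \<longlonglongrightarrow> 1"
  shows "\<exists>f :: real \<Rightarrow> ennreal. distributed M lborel X f \<and> lower_semicontinuous f \<and>
    (\<forall>x. antimono_on {0<..} (\<lambda>\<epsilon>. sign_mean M X (W \<epsilon>) x) \<and>
         ((\<lambda>\<epsilon>. ereal (sign_mean M X (W \<epsilon>) x)) \<longlongrightarrow> enn2ereal (f x)) (at_right 0))"
proof -
  define g where "g \<epsilon> x = sign_mean M X (W \<epsilon>) x" for \<epsilon> x
  define r where "r n = 1 / real (Suc n)" for n
  have r: "0 < r n" for n by (simp add: r_def)
  have rdec: "r (Suc n) \<le> r n" for n by (simp add: r_def field_simps)
  define f where "f x = (SUP n. ennreal (g (r n) x))" for x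
  have no_atoms: "\<And>c. AE \<omega> in M. X \<omega> \<noteq> c"
    by (rule ibp_pair_no_atoms[OF ibp[of 1] X Rpos]) auto
  have gcont: "continuous_on UNIV (g \<epsilon>)" if "0 < \<epsilon>" for \<epsilon>
    using ibp_pair_continuous[OF ibp[OF that] X no_atoms] by (simp add: g_def[abs_def])
  have [measurable]: "g (r n) \<in> borel_measurable borel" for n
    by (rule borel_measurable_continuous_onI[OF gcont[OF r]])
  have [measurable]: "R (r n) \<in> borel_measurable M" for n
    using ibp[OF r[of n]] by (auto simp: ibp_pair_def)
  have gnn: "0 \<le> g \<epsilon> x" if "0 < \<epsilon>" for \<epsilon> x
    unfolding g_def
    by (rule ibp_pair_nonneg[OF ibp[OF that] X no_atoms]) (use Rpos[OF that] in eventually_elim, simp)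
  have gmono: "g \<delta> x \<le> g \<epsilon> x" if "0 < \<epsilon>" "\<epsilon> \<le> \<delta>" for \<epsilon> \<delta> x
  proof -
    have "0 < \<delta>" using that by simp
    \<comment> \<open>The difference of the pairs at \<epsilon> and \<delta> is again an integration
      by parts pair, with nonnegative first weight.\<close>
    have "0 \<le> sign_mean M X (\<lambda>\<omega>. W \<epsilon> \<omega> - W \<delta> \<omega>) x"
      by (rule ibp_pair_nonneg[OF ibp_pair_diff[OF ibp[OF that(1)] ibp[OF \<open>0 < \<delta>\<close>] X] X no_atoms])
        (use Rmono[OF that] in eventually_elim, simp)
    also have "\<dots> = g \<epsilon> x - g \<delta> x"
      unfolding g_def using ibp[OF that(1)] ibp[OF \<open>0 < \<delta>\<close>]
      by (intro sign_mean_diff) (auto simp: ibp_pair_def)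
    finally show ?thesis by simp
  qed
  \<comment> \<open>The supremum runs over the sequence \<open>r n\<close> only; as this sequence
    tends to 0 and \<open>g\<close> is monotone, it bounds every \<epsilon>.\<close>
  have fge: "ennreal (g \<epsilon> x) \<le> f x" if \<epsilon>: "0 < \<epsilon>" for \<epsilon> x
  proof -
    obtain n where "r n < \<epsilon>"
      using reals_Archimedean[OF \<epsilon>] by (auto simp: r_def inverse_eq_divide)
    then have "ennreal (g \<epsilon> x) \<le> ennreal (g (r n) x)"
      using r by (intro ennreal_leI gmono) auto
    also have "\<dots> \<le> f x"
      unfolding f_def by (rule SUP_upper) simp
    finally show ?thesis .
  qed
  have "distr M lborel X = density lborel f"
  proof (rule measure_eqI)
    fix B assume "B \<in> sets (distr M lborel X)"
    then have [measurable]: "B \<in> sets borel" by simp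
    let ?B = "X -` B \<inter> space M"
    have eq: "(\<integral>\<^sup>+\<omega>. ennreal (R (r n) \<omega>) * indicator ?B \<omega> \<partial>M) =
        (\<integral>\<^sup>+x. ennreal (g (r n) x) * indicator B x \<partial>lborel)" for n
    proof -
      have "AE \<omega> in M. 0 \<le> R (r n) \<omega>"
        using Rpos[OF r[of n]] by eventually_elim simp
      then have "distr (density M (\<lambda>\<omega>. ennreal (R (r n) \<omega>))) borel X =
          density lborel (\<lambda>x. ennreal (g (r n) x))"
        unfolding g_def by (rule ibp_pair_distr[OF ibp[OF r] X no_atoms])
      then have "emeasure (distr (density M (\<lambda>\<omega>. ennreal (R (r n) \<omega>))) borel X) B =
          emeasure (density lborel (\<lambda>x. ennreal (g (r n) x))) B"
        by simp
      then show ?thesis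
        by (simp add: emeasure_distr emeasure_density)
    qed
    have "AE \<omega> in M. \<forall>n. 0 < R (r n) \<omega> \<and> R (r n) \<omega> \<le> R (r (Suc n)) \<omega>"
      using Rpos[OF r] Rmono[OF r rdec] by (simp add: AE_all_countable)
    then have mono: "AE \<omega> in M. incseq (\<lambda>n. ennreal (R (r n) \<omega>))"
      by eventually_elim (auto intro!: incseq_SucI ennreal_leI)
    then have "AE \<omega> in M. (SUP n. ennreal (R (r n) \<omega>)) = 1"
      using Rlim
    proof eventually_elim
      case (elim \<omega>)
      have "(\<lambda>n. ennreal (R (r n) \<omega>)) \<longlonglongrightarrow> ennreal 1"
        using elim(2) unfolding r_def by (rule tendsto_ennrealI)
      then show ?case
        using LIMSEQ_unique[OF LIMSEQ_SUP[OF elim(1)]] by simp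
    qed
    then have "(\<integral>\<^sup>+\<omega>. indicator ?B \<omega> \<partial>M) =
        (\<integral>\<^sup>+\<omega>. (SUP n. ennreal (R (r n) \<omega>) * indicator ?B \<omega>) \<partial>M)"
      by (intro nn_integral_cong_AE, eventually_elim) (simp add: SUP_mult_right_ennreal[symmetric])
    then have "emeasure M ?B = (\<integral>\<^sup>+\<omega>. (SUP n. ennreal (R (r n) \<omega>) * indicator ?B \<omega>) \<partial>M)"
      by simp
    also have "\<dots> = (SUP n. \<integral>\<^sup>+\<omega>. ennreal (R (r n) \<omega>) * indicator ?B \<omega> \<partial>M)"
    proof (rule nn_integral_monotone_convergence_SUP_AE)
      show "AE \<omega> in M. ennreal (R (r n) \<omega>) * indicator ?B \<omega> \<le> ennreal (R (r (Suc n)) \<omega>) * indicator ?B \<omega>" for n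
        using mono by eventually_elim (auto intro!: mult_right_mono dest: incseq_SucD)
    qed measurable
    also have "\<dots> = (SUP n. \<integral>\<^sup>+x. ennreal (g (r n) x) * indicator B x \<partial>lborel)"
      by (simp add: eq)
    also have "\<dots> = (\<integral>\<^sup>+x. (SUP n. ennreal (g (r n) x) * indicator B x) \<partial>lborel)"
      by (rule nn_integral_monotone_convergence_SUP[symmetric])
        (auto intro!: incseq_SucI le_funI mult_right_mono ennreal_leI gmono r rdec)
    also have "\<dots> = emeasure (density lborel f) B"
      by (simp add: emeasure_density f_def[abs_def] SUP_mult_right_ennreal[symmetric])
    finally show "emeasure (distr M lborel X) B = emeasure (density lborel f) B"
      by (simp add: emeasure_distr)
  qed simp
  then have "distributed M lborel X f"
    unfolding distributed_def f_def[abs_def] by simp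
  moreover have "lower_semicontinuous f"
    unfolding lower_semicontinuous_def
  proof
    fix x
    \<comment> \<open>Each continuous minorant of \<open>f\<close> is below the lower limit of
      \<open>f\<close>; the supremum over \<open>n\<close> follows.\<close>
    have "ennreal (g (r n) x) \<le> Liminf (at x) f" for n
    proof -
      have "isCont (g (r n)) x"
        using gcont[OF r] by (simp add: continuous_on_eq_continuous_at)
      then have "((\<lambda>y. ennreal (g (r n) y)) \<longlongrightarrow> ennreal (g (r n) x)) (at x)"
        by (intro tendsto_ennrealI) (simp add: isCont_def)
      then have "ennreal (g (r n) x) = Liminf (at x) (\<lambda>y. ennreal (g (r n) y))"
        by (intro lim_imp_Liminf[symmetric]) auto
      also have "\<dots> \<le> Liminf (at x) f"
        by (rule Liminf_mono) (simp add: fge r)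
      finally show ?thesis .
    qed
    then show "f x \<le> Liminf (at x) f"
      unfolding f_def[of x] by (rule SUP_least)
  qed
  moreover have "antimono_on {0<..} (\<lambda>\<epsilon>. g \<epsilon> x)" for x
    by (rule monotone_onI) (auto intro: gmono)
  moreover have "((\<lambda>\<epsilon>. ereal (g \<epsilon> x)) \<longlongrightarrow> enn2ereal (f x)) (at_right 0)" for x
  proof -
    \<comment> \<open>A level below \<open>f x\<close> is exceeded at some \<open>r n\<close> and
      then, by monotonicity, at every smaller \<epsilon>; a level above \<open>f x\<close> is never
      reached by \<open>fge\<close>.\<close>
    have "((\<lambda>\<epsilon>. ennreal (g \<epsilon> x)) \<longlongrightarrow> f x) (at_right 0)"
    proof (rule order_tendstoI)
      fix l assume "l < f x"
      then obtain n where n: "l < ennreal (g (r n) x)"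
        unfolding f_def less_SUP_iff by auto
      have "eventually (\<lambda>\<epsilon>. \<epsilon> \<in> {0<..<r n}) (at_right 0)"
        by (rule eventually_at_right_real[OF r])
      then show "eventually (\<lambda>\<epsilon>. l < ennreal (g \<epsilon> x)) (at_right 0)"
      proof eventually_elim
        case (elim \<epsilon>)
        then show ?case
          by (intro less_le_trans[OF n] ennreal_leI gmono) auto
      qed
    next
      fix u assume u: "f x < u"
      have "eventually (\<lambda>\<epsilon>. \<epsilon> \<in> {0<..<r 0}) (at_right 0)"
        by (rule eventually_at_right_real[OF r])
      then show "eventually (\<lambda>\<epsilon>. ennreal (g \<epsilon> x) < u) (at_right 0)"
        by eventually_elim (use u fge in \<open>auto intro: le_less_trans\<close>)
    qed
    then have "((\<lambda>\<epsilon>. enn2ereal (ennreal (g \<epsilon> x))) \<longlongrightarrow> enn2ereal (f x)) (at_right 0)"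
      by (rule tendsto_enn2erealI)
    moreover have "eventually (\<lambda>\<epsilon>. \<epsilon> \<in> {0<..<r 0}) (at_right 0)"
      by (rule eventually_at_right_real[OF r])
    \<comment> \<open>The passage through \<open>ennreal\<close> preserves the value because
      \<open>g\<close> is nonnegative, which is known for positive \<epsilon>.\<close>
    then have "eventually (\<lambda>\<epsilon>. enn2ereal (ennreal (g \<epsilon> x)) = ereal (g \<epsilon> x)) (at_right 0)"
      by eventually_elim (simp add: gnn)
    ultimately show ?thesis
      by (rule Lim_transform_eventually)
  qed
  ultimately show ?thesis
    unfolding g_def by blast
qed

theorem theorem3p1:
  fixes M :: "'a measure"
    and D DA :: "('a \<Rightarrow> real) set"
    and \<Gamma> :: "('a \<Rightarrow> real) \<Rightarrow> ('a \<Rightarrow> real) \<Rightarrow> ('a \<Rightarrow> real)"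
    and A :: "('a \<Rightarrow> real) \<Rightarrow> ('a \<Rightarrow> real)"
    and X :: "'a \<Rightarrow> real"
  assumes "error_structure M D \<Gamma>"
    and "generator M D \<Gamma> DA A"
    and "X \<in> borel_measurable M"
    and "X \<in> DA"
    and "\<Gamma> X X \<in> D"
    and "AE \<omega> in M. 0 < \<Gamma> X X \<omega>"
  shows
    "(let g = (\<lambda>\<epsilon> x. 1 / 2 * (\<integral>\<omega>. sgn (x - X \<omega>) *
                  (\<Gamma> X (\<lambda>\<omega>. 1 / (\<epsilon> + \<Gamma> X X \<omega>)) \<omega> + 2 * A X \<omega> / (\<epsilon> + \<Gamma> X X \<omega>)) \<partial>M))
      in \<exists>f ftilde :: real \<Rightarrow> ennreal.
           distributed M lborel X f \<and>
           (AE x in lborel. f x = ftilde x) \<and>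
           lower_semicontinuous ftilde \<and>
           (\<forall>x. antimono_on {0<..} (\<lambda>\<epsilon>. g \<epsilon> x) \<and>
                ((\<lambda>\<epsilon>. ereal (g \<epsilon> x)) \<longlongrightarrow> enn2ereal (ftilde x)) (at_right 0)))
     \<and>
     ((\<lambda>\<omega>. 1 / \<Gamma> X X \<omega>) \<in> D \<longrightarrow>
        (\<exists>f :: real \<Rightarrow> real.
           (\<forall>x. 0 \<le> f x) \<and>
           distributed M lborel X (\<lambda>x. ennreal (f x)) \<and>
           abs_continuous_on UNIV f \<and>
           (\<forall>x. f x = 1 / 2 * (\<integral>\<omega>. sgn (x - X \<omega>) *
                  (\<Gamma> X (\<lambda>\<omega>. 1 / \<Gamma> X X \<omega>) \<omega> + 2 * A X \<omega> / \<Gamma> X X \<omega>) \<partial>M))))"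
proof -
  interpret error_structure M D \<Gamma> by fact
  note X = \<open>X \<in> borel_measurable M\<close>
  note G = \<open>AE \<omega> in M. 0 < \<Gamma> X X \<omega>\<close>
  let ?R = "\<lambda>\<epsilon> \<omega>. \<Gamma> X X \<omega> / (\<epsilon> + \<Gamma> X X \<omega>)"
  let ?W = "\<lambda>\<epsilon> \<omega>. \<Gamma> X (\<lambda>\<omega>. 1 / (\<epsilon> + \<Gamma> X X \<omega>)) \<omega> + 2 * A X \<omega> / (\<epsilon> + \<Gamma> X X \<omega>)"
  have "\<exists>f :: real \<Rightarrow> ennreal. distributed M lborel X f \<and> lower_semicontinuous f \<and>
    (\<forall>x. antimono_on {0<..} (\<lambda>\<epsilon>. sign_mean M X (?W \<epsilon>) x) \<and>
         ((\<lambda>\<epsilon>. ereal (sign_mean M X (?W \<epsilon>) x)) \<longlongrightarrow> enn2ereal (f x)) (at_right 0))"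
  proof (rule ibp_family_density[where R = ?R])
    show "ibp_pair M X (?R \<epsilon>) (?W \<epsilon>)" if "0 < \<epsilon>" for \<epsilon>
      using assms that by (intro ibp_pair_generator)
    show "AE \<omega> in M. 0 < ?R \<epsilon> \<omega>" if "0 < \<epsilon>" for \<epsilon>
      using G by eventually_elim (use that in simp)
    show "AE \<omega> in M. ?R \<delta> \<omega> \<le> ?R \<epsilon> \<omega>" if "0 < \<epsilon>" "\<epsilon> \<le> \<delta>" for \<epsilon> \<delta>
      using G by eventually_elim (use that in \<open>auto intro!: divide_left_mono mult_pos_pos add_pos_pos\<close>)
    show "AE \<omega> in M. (\<lambda>n. ?R (1 / real (Suc n)) \<omega>) \<longlonglongrightarrow> 1"
      using G
    proof eventually_elim
      case (elim \<omega>)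
      have "(\<lambda>n. ?R (1 / real (Suc n)) \<omega>) \<longlonglongrightarrow> \<Gamma> X X \<omega> / (0 + \<Gamma> X X \<omega>)"
        using elim by (intro tendsto_divide tendsto_add tendsto_const LIMSEQ_Suc[OF lim_1_over_n]) auto
      then show ?case using elim by simp
    qed
  qed fact
  then obtain f where f: "distributed M lborel X f" "lower_semicontinuous f"
    "\<And>x. antimono_on {0<..} (\<lambda>\<epsilon>. sign_mean M X (?W \<epsilon>) x)"
    "\<And>x. ((\<lambda>\<epsilon>. ereal (sign_mean M X (?W \<epsilon>) x)) \<longlongrightarrow> enn2ereal (f x)) (at_right 0)"
    by blast
  have b: "\<exists>f :: real \<Rightarrow> real. (\<forall>x. 0 \<le> f x) \<and> distributed M lborel X (\<lambda>x. ennreal (f x)) \<and>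
      abs_continuous_on UNIV f \<and> (\<forall>x. f x = 1 / 2 * (\<integral>\<omega>. sgn (x - X \<omega>) *
        (\<Gamma> X (\<lambda>\<omega>. 1 / \<Gamma> X X \<omega>) \<omega> + 2 * A X \<omega> / \<Gamma> X X \<omega>) \<partial>M))"
    if "(\<lambda>\<omega>. 1 / \<Gamma> X X \<omega>) \<in> D"
  proof -
    let ?V = "\<lambda>\<omega>. \<Gamma> X (\<lambda>\<omega>. 1 / \<Gamma> X X \<omega>) \<omega> + 2 * A X \<omega> / \<Gamma> X X \<omega>"
    have ibp: "ibp_pair M X (\<lambda>_. 1) ?V"
      using assms that by (intro ibp_pair_generator_inverse)
    have no_atoms: "\<And>c. AE \<omega> in M. X \<omega> \<noteq> c"
      by (rule ibp_pair_no_atoms[OF ibp X]) simp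
    have "continuous_on UNIV (sign_mean M X ?V)"
      by (rule ibp_pair_continuous[OF ibp X no_atoms])
    then have "sign_mean M X ?V \<in> borel_measurable borel"
      by (rule borel_measurable_continuous_onI)
    \<comment> \<open>A density equal to 1 leaves the measure unchanged, so with
      \<open>R = 1\<close> the weighted law is the law of \<open>X\<close> itself.\<close>
    moreover have "distr M lborel X = distr (density M (\<lambda>_. ennreal 1)) borel X"
      by (intro distr_cong) (auto simp: density_1)
    ultimately have "distributed M lborel X (\<lambda>x. ennreal (sign_mean M X ?V x))"
      using ibp_pair_distr[OF ibp X no_atoms] X by (simp add: distributed_def)
    moreover have "0 \<le> sign_mean M X ?V x" for x
      by (rule ibp_pair_nonneg[OF ibp X no_atoms]) simp
    ultimately show ?thesis
      using ibp_pair_abs_continuous[OF ibp X] by (intro exI[of _ "sign_mean M X ?V"]) (simp add: sign_mean_def)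
  qed
  show ?thesis
    unfolding Let_def
  proof (rule conjI, goal_cases)
    case 1
    show ?case
      \<comment> \<open>The density already constructed is lower semicontinuous, so it serves as its
        own version.\<close>
      by (rule exI[of _ f], rule exI[of _ f]) (use f in \<open>simp add: sign_mean_def\<close>)
  next
    case 2
    show ?case
      by (rule impI, rule b)
  qed
qed

end
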